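(* For every positive integer $n$, each of the following $45$ statistics $f:S_n\to\mathbb{Z}$ is homomesic with respect to the Lehmer code rotation $\mathcal{L}$ acting on $S_n$ (that is, for each statistic there is a constant $c$, possibly depending on $n$, such that the average of $f$ over every orbit of $\mathcal{L}$ equals $c$). Here $\sigma=\sigma_1\cdots\sigma_n\in S_n$. Statistics related to inversions: (1) the number of inversions $\mathrm{inv}(\sigma)$; (2) the number of non-inversions, i.e. of pairs $i<j$ with $\sigma_i<\sigma_j$; (3) the number of inversions of distance at most $2$, i.e. inversions $(i,j)$ with $j-i\le 2$; (4) the number of inversions of the third entry, $\#\{j>3:\sigma_j<\sigma_3\}$; (5) the number of inversions of the second entry, $\#\{j>2:\sigma_j<\sigma_2\}$. Statistics related to descents: (6) the major index $\mathrm{maj}(\sigma)$; (7) the number of descents; (8) the number of (inner) peaks; (9) the number of left outer peaks; (10) the number of outer peaks; (11) the number of valleys including the boundary; (12) the number of ascents; (13) the number of (inner) valleys; (14) the number of double ascents; (15) the number of double descents; (16) the number of runs; (17) the number of times the permutation switches from increasing to decreasing or from decreasing to increasing; (18) the number of up-down runs; (19) the comajor index; (20) the number of right outer peaks; (21) the number of descents of distance $2$; (22) the number of ascents of distance $2$; (23) the number of odd descents; (24) the number of even descents. Statistics related to patterns: (25)–(30) for each of the six vincular patterns $21\text{-}3$, $13\text{-}2$, $12\text{-}3$, $31\text{-}2$, $23\text{-}1$, $32\text{-}1$, the number of its occurrences; (31) the number of occurrences of $123$ plus the number of occurrences of $132$; (32) the number of occurrences of $213$ plus the number of occurrences of $231$;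 (33) the number of occurrences of $312$ plus the number of occurrences of $321$; (34) the number of occurrences of $14\text{-}2\text{-}3$ or $14\text{-}3\text{-}2$; (35) the number of occurrences of the vincular pattern $|1\text{-}23$. Other statistics: (36) the number of right-to-left maxima; (37) the rank of $\sigma$; (38) the first entry $\sigma_1$; (39) the width of the permutation tree of $\sigma$; (40) the Babson–Steingrímsson statistic $\mathrm{stat}$; (41) the Babson–Steingrímsson statistic $\mathrm{stat}'$; (42) the number of right-to-left minima; (43) $\mathrm{maj}(\sigma)-\mathrm{inv}(\sigma)$; (44) $\mathrm{inv}(\sigma)+\mathrm{maj}(\sigma)$; (45) the number of ascent tops $i$ such that all values smaller than $\sigma_i$ appear before position $i$.
   Context: Homomesy: given a finite set $S$, a bijection $\mathcal{X}:S\to S$ and $f:S\to\mathbb{Z}$, the triple is $c$-mesic (homomesic) if for every orbit $\mathcal{O}$ of $\mathcal{X}$, $\frac{1}{|\mathcal{O}|}\sum_{x\in\mathcal{O}}f(x)=c$. Permutations $\sigma\in S_n$ are written in one-line notation $\sigma_1\cdots\sigma_n$. The Lehmer code of $\sigma$ is $L(\sigma)=(L(\sigma)_1,\dots,L(\sigma)_n)$ with $L(\sigma)_i=\#\{j>i:\sigma_j<\sigma_i\}\in\{0,\dots,n-i\}$; this is a bijection between $S_n$ and such tuples. The Lehmer code rotation $\mathcal{L}:S_n\to S_n$ sends $\sigma$ to the unique $\tau$ with $L(\tau)_i\equiv L(\sigma)_i+1 \pmod{n-i+1}$, $L(\tau)_i\in\{0,\dots,n-i\}$, for all $i$. An inversion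 is a pair of positions $(i,j)$, $i<j$, with $\sigma_i>\sigma_j$. Index $i\in[n-1]$ is a descent if $\sigma_i>\sigma_{i+1}$ and an ascent otherwise. A peak (inner peak) is an index $i$ that is an ascent with $i+1$ a descent; a valley (inner valley) is an index $i$ that is a descent with $i+1$ an ascent. A double ascent is $i$ with $\sigma_i<\sigma_{i+1}<\sigma_{i+2}$; a double descent is $i$ with $\sigma_i>\sigma_{i+1}>\sigma_{i+2}$. A left outer peak is a peak, or the index $1$ if $1$ is a descent; a right outer peak is a peak, or the index $n-1$ if $n-1$ is an ascent; the number of outer peaks is the number of peaks plus $1$ if $1$ is a descent plus $1$ if $n-1$ is an ascent. The number of valleys including the boundary is the number of valleys, plus $1$ if $1$ is an ascent, plus $1$ if $n-1$ is a descent. The number of switches between increasing and decreasing is the number of peaks plus the number of valleys. The number of up-down runs is the number of maximal monotone contiguous subsequences, counting additionally the first entry alone if $1$ is a descent (equivalently, $1+\#\text{peaks}+\#\text{valleys}+[\sigma_1>\sigma_2]$). $\mathrm{maj}(\sigma)=\sum_{i\text{ descent}} i$; the comajor index is $\sum_{i \text{ descent}}(n-i)$. A run is a maximal contiguous increasing subsequence. A descent of distance $2$ is $i\in[n-2]$ with $\sigma_i>\sigma_{i+2}$, otherwise $i$ is an ascent of distance $2$. Odd (even) descents are descents $i$ with $i$ odd (even). An ascent top is a position $i\ge2$ with $\sigma_{i-1}<\sigma_i$. An occurrence of a classical pattern $abc$ is a triple of positions $i_1<i_2<i_3$ with $\sigma_{i_1}\sigma_{i_2}\sigma_{i_3}$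 in the same relative order as $abc$. An occurrence of the vincular pattern $ab\text{-}c$ is such an occurrence with $i_2=i_1+1$; of $a\text{-}bc$, one with $i_3=i_2+1$. An occurrence of $14\text{-}2\text{-}3$ or $14\text{-}3\text{-}2$ is a set of positions $i,i+1,\ell,m$ with $i+1<\ell<m$ and $\sigma_i<\sigma_\ell,\sigma_m<\sigma_{i+1}$. An occurrence of $|1\text{-}23$ is an occurrence of $123$ at positions $1,2,k$. A right-to-left maximum (minimum) is an entry $\sigma_i$ larger (smaller) than all $\sigma_j$ with $j>i$. The rank of $\sigma$ is its position (from $1$ to $n!$) among all permutations of $[n]$ in lexicographic order. The permutation tree of $\sigma$ is the rooted tree on $\{0,\dots,n\}$ with root $0$ in which $\sigma_1$ is a child of the root and, for each $i$, $\sigma_{i+1}$ is attached as a child of the first node smaller than $\sigma_{i+1}$ on the path from $\sigma_i$ to the root; its width is its number of leaves. The Babson–Steingrímsson statistic $\mathrm{stat}$ is the total number of occurrences of $13\text{-}2$, $21\text{-}3$, $32\text{-}1$ plus the number of descents; $\mathrm{stat}'$ is the total number of occurrences of $13\text{-}2$, $31\text{-}2$, $32\text{-}1$ plus the number of descents. *)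

theory Defs
  imports Complex_Main "HOL-Combinatorics.Combinatorics"
begin

section \<open>Homomesy\<close>

definition c_mesic :: "'a set \<Rightarrow> ('a \<Rightarrow> 'a) \<Rightarrow> ('a \<Rightarrow> int) \<Rightarrow> real \<Rightarrow> bool" where
  "c_mesic S X f c \<longleftrightarrow> finite S \<and> bij_betw X S S \<and>
     (\<forall>x\<in>S. (\<Sum>y\<in>orbit X x. real_of_int (f y)) / real (card (orbit X x)) = c)"

definition homomesic :: "'a set \<Rightarrow> ('a \<Rightarrow> 'a) \<Rightarrow> ('a \<Rightarrow> int) \<Rightarrow> bool" where
  "homomesic S X f \<longleftrightarrow> (\<exists>c. c_mesic S X f c)"


section \<open>Permutations and the Lehmer code rotation\<close>

text \<open>
  A permutation of \<open>{1..n}\<close> is a function \<open>\<sigma>\<close> that permutes \<open>{1..n}\<close> (and is the identity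
  elsewhere); the entries of its one-line notation are \<open>\<sigma> 1, \<dots>, \<sigma> n\<close>. Positions are 1-based.
\<close>

definition Sym :: "nat \<Rightarrow> (nat \<Rightarrow> nat) set" where
  "Sym n = {\<sigma>. \<sigma> permutes {1..n}}"

definition lehmer_code :: "nat \<Rightarrow> (nat \<Rightarrow> nat) \<Rightarrow> nat \<Rightarrow> nat" where
  "lehmer_code n \<sigma> i = card {j \<in> {i<..n}. \<sigma> j < \<sigma> i}"

definition lehmer_rotation :: "nat \<Rightarrow> (nat \<Rightarrow> nat) \<Rightarrow> (nat \<Rightarrow> nat)" where
  "lehmer_rotation n \<sigma> = (THE \<tau>. \<tau> \<in> Sym n \<and>
     (\<forall>i\<in>{1..n}. lehmer_code n \<tau> i = (lehmer_code n \<sigma> i + 1) mod (n - i + 1)))"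


section \<open>Inversions, descents, peaks, valleys, runs\<close>

definition inversions :: "nat \<Rightarrow> (nat \<Rightarrow> nat) \<Rightarrow> (nat \<times> nat) set" where
  "inversions n \<sigma> = {(i, j). 1 \<le> i \<and> i < j \<and> j \<le> n \<and> \<sigma> i > \<sigma> j}"

definition noninversions :: "nat \<Rightarrow> (nat \<Rightarrow> nat) \<Rightarrow> (nat \<times> nat) set" where
  "noninversions n \<sigma> = {(i, j). 1 \<le> i \<and> i < j \<and> j \<le> n \<and> \<sigma> i < \<sigma> j}"

definition descents :: "nat \<Rightarrow> (nat \<Rightarrow> nat) \<Rightarrow> nat set" where
  "descents n \<sigma> = {i \<in> {1..<n}. \<sigma> i > \<sigma> (i + 1)}"

definition ascents :: "nat \<Rightarrow> (nat \<Rightarrow> nat) \<Rightarrow> nat set" where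
  "ascents n \<sigma> = {1..<n} - descents n \<sigma>"

definition major_index :: "nat \<Rightarrow> (nat \<Rightarrow> nat) \<Rightarrow> nat" where
  "major_index n \<sigma> = (\<Sum>i\<in>descents n \<sigma>. i)"

definition comajor_index :: "nat \<Rightarrow> (nat \<Rightarrow> nat) \<Rightarrow> nat" where
  "comajor_index n \<sigma> = (\<Sum>i\<in>descents n \<sigma>. n - i)"

definition peaks :: "nat \<Rightarrow> (nat \<Rightarrow> nat) \<Rightarrow> nat set" where
  "peaks n \<sigma> = {i. i \<in> ascents n \<sigma> \<and> i + 1 \<in> descents n \<sigma>}"

definition valleys :: "nat \<Rightarrow> (nat \<Rightarrow> nat) \<Rightarrow> nat set" where
  "valleys n \<sigma> = {i. i \<in> descents n \<sigma> \<and> i + 1 \<in> ascents n \<sigma>}"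

definition left_outer_peaks :: "nat \<Rightarrow> (nat \<Rightarrow> nat) \<Rightarrow> nat set" where
  "left_outer_peaks n \<sigma> = {i. i \<in> peaks n \<sigma> \<or> i = 1 \<and> 1 \<in> descents n \<sigma>}"

definition right_outer_peaks :: "nat \<Rightarrow> (nat \<Rightarrow> nat) \<Rightarrow> nat set" where
  "right_outer_peaks n \<sigma> = {i. i \<in> peaks n \<sigma> \<or> i = n - 1 \<and> n - 1 \<in> ascents n \<sigma>}"

definition num_outer_peaks :: "nat \<Rightarrow> (nat \<Rightarrow> nat) \<Rightarrow> nat" where
  "num_outer_peaks n \<sigma> =
     card (peaks n \<sigma>) + of_bool (1 \<in> descents n \<sigma>) + of_bool (n - 1 \<in> ascents n \<sigma>)"

definition num_valleys_with_boundary :: "nat \<Rightarrow> (nat \<Rightarrow> nat) \<Rightarrow> nat" where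
  "num_valleys_with_boundary n \<sigma> =
     card (valleys n \<sigma>) + of_bool (1 \<in> ascents n \<sigma>) + of_bool (n - 1 \<in> descents n \<sigma>)"

definition double_ascents :: "nat \<Rightarrow> (nat \<Rightarrow> nat) \<Rightarrow> nat set" where
  "double_ascents n \<sigma> = {i. 1 \<le> i \<and> i + 2 \<le> n \<and> \<sigma> i < \<sigma> (i + 1) \<and> \<sigma> (i + 1) < \<sigma> (i + 2)}"

definition double_descents :: "nat \<Rightarrow> (nat \<Rightarrow> nat) \<Rightarrow> nat set" where
  "double_descents n \<sigma> = {i. 1 \<le> i \<and> i + 2 \<le> n \<and> \<sigma> i > \<sigma> (i + 1) \<and> \<sigma> (i + 1) > \<sigma> (i + 2)}"

text \<open>
  A contiguous subsequence \<open>\<sigma> a, \<dots>, \<sigma> b\<close> is identified with the pair \<open>(a, b)\<close>; maximality of a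
  segment is with respect to inclusion among the segments satisfying \<open>P\<close>.
\<close>

definition maximal_segments :: "nat \<Rightarrow> (nat set \<Rightarrow> bool) \<Rightarrow> (nat \<times> nat) set" where
  "maximal_segments n P = {(a, b). 1 \<le> a \<and> a \<le> b \<and> b \<le> n \<and> P {a..b} \<and>
     (\<forall>a' b'. 1 \<le> a' \<and> a' \<le> a \<and> b \<le> b' \<and> b' \<le> n \<and> P {a'..b'} \<longrightarrow> a' = a \<and> b' = b)}"

definition runs :: "nat \<Rightarrow> (nat \<Rightarrow> nat) \<Rightarrow> (nat \<times> nat) set" where
  "runs n \<sigma> = maximal_segments n (\<lambda>A. strict_mono_on A \<sigma>)"

definition num_updown_runs :: "nat \<Rightarrow> (nat \<Rightarrow> nat) \<Rightarrow> nat" where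
  "num_updown_runs n \<sigma> =
     card (maximal_segments n (\<lambda>A. strict_mono_on A \<sigma> \<or> strict_antimono_on A \<sigma>))
     + of_bool (1 \<in> descents n \<sigma>)"

definition descents_dist2 :: "nat \<Rightarrow> (nat \<Rightarrow> nat) \<Rightarrow> nat set" where
  "descents_dist2 n \<sigma> = {i. 1 \<le> i \<and> i + 2 \<le> n \<and> \<sigma> i > \<sigma> (i + 2)}"

definition ascents_dist2 :: "nat \<Rightarrow> (nat \<Rightarrow> nat) \<Rightarrow> nat set" where
  "ascents_dist2 n \<sigma> = {i. 1 \<le> i \<and> i + 2 \<le> n} - descents_dist2 n \<sigma>"


section \<open>Patterns\<close>

definition same_relative_order :: "nat list \<Rightarrow> nat list \<Rightarrow> bool" where
  "same_relative_order xs ys \<longleftrightarrow> length xs = length ys \<and>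
     (\<forall>k<length xs. \<forall>l<length xs. xs ! k < xs ! l \<longleftrightarrow> ys ! k < ys ! l)"

text \<open>Patterns of length three are given as lists, e.g. \<open>[1, 3, 2]\<close> for \<open>132\<close>.\<close>

definition occurrences :: "nat list \<Rightarrow> nat \<Rightarrow> (nat \<Rightarrow> nat) \<Rightarrow> (nat \<times> nat \<times> nat) set" where
  "occurrences p n \<sigma> = {(i, j, k). 1 \<le> i \<and> i < j \<and> j < k \<and> k \<le> n \<and>
     same_relative_order [\<sigma> i, \<sigma> j, \<sigma> k] p}"

text \<open>For a list \<open>[a, b, c]\<close> this counts the vincular pattern \<open>ab-c\<close>.\<close>

definition vinc_occurrences :: "nat list \<Rightarrow> nat \<Rightarrow> (nat \<Rightarrow> nat) \<Rightarrow> (nat \<times> nat \<times> nat) set" where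
  "vinc_occurrences p n \<sigma> = {(i, j, k) \<in> occurrences p n \<sigma>. j = i + 1}"

text \<open>
  Occurrences of \<open>14-2-3\<close> or \<open>14-3-2\<close> at positions \<open>i, i + 1, l, m\<close>.
\<close>

definition occurrences_14_23 :: "nat \<Rightarrow> (nat \<Rightarrow> nat) \<Rightarrow> (nat \<times> nat \<times> nat) set" where
  "occurrences_14_23 n \<sigma> = {(i, l, m). 1 \<le> i \<and> i + 1 < l \<and> l < m \<and> m \<le> n \<and>
     \<sigma> i < \<sigma> l \<and> \<sigma> l < \<sigma> (i + 1) \<and> \<sigma> i < \<sigma> m \<and> \<sigma> m < \<sigma> (i + 1)}"

text \<open>Occurrences of \<open>|1-23\<close>: the first two matched positions are \<open>1\<close> and \<open>2\<close>.\<close>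

definition occurrences_initial_123 :: "nat \<Rightarrow> (nat \<Rightarrow> nat) \<Rightarrow> (nat \<times> nat \<times> nat) set" where
  "occurrences_initial_123 n \<sigma> = {(i, j, k) \<in> occurrences [1, 2, 3] n \<sigma>. i = 1 \<and> j = 2}"

definition bs_stat :: "nat \<Rightarrow> (nat \<Rightarrow> nat) \<Rightarrow> nat" where
  "bs_stat n \<sigma> = card (vinc_occurrences [1, 3, 2] n \<sigma>) + card (vinc_occurrences [2, 1, 3] n \<sigma>)
     + card (vinc_occurrences [3, 2, 1] n \<sigma>) + card (descents n \<sigma>)"

definition bs_stat' :: "nat \<Rightarrow> (nat \<Rightarrow> nat) \<Rightarrow> nat" where
  "bs_stat' n \<sigma> = card (vinc_occurrences [1, 3, 2] n \<sigma>) + card (vinc_occurrences [3, 1, 2] n \<sigma>)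
     + card (vinc_occurrences [3, 2, 1] n \<sigma>) + card (descents n \<sigma>)"


section \<open>Other statistics\<close>

definition rl_maxima :: "nat \<Rightarrow> (nat \<Rightarrow> nat) \<Rightarrow> nat set" where
  "rl_maxima n \<sigma> = {i \<in> {1..n}. \<forall>j\<in>{i<..n}. \<sigma> i > \<sigma> j}"

definition rl_minima :: "nat \<Rightarrow> (nat \<Rightarrow> nat) \<Rightarrow> nat set" where
  "rl_minima n \<sigma> = {i \<in> {1..n}. \<forall>j\<in>{i<..n}. \<sigma> i < \<sigma> j}"

definition one_line :: "nat \<Rightarrow> (nat \<Rightarrow> nat) \<Rightarrow> nat list" where
  "one_line n \<sigma> = map \<sigma> [1..<n + 1]"

definition lex_rank :: "nat \<Rightarrow> (nat \<Rightarrow> nat) \<Rightarrow> nat" where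
  "lex_rank n \<sigma> =
     1 + card {\<tau> \<in> Sym n. (one_line n \<tau>, one_line n \<sigma>) \<in> lexord {(x, y). x < y}}"

text \<open>
  \<open>tree_path \<sigma> i\<close> lists the nodes on the path from \<open>\<sigma> i\<close> (from the root \<open>0\<close> if \<open>i = 0\<close>) to the
  root in the permutation tree. The node \<open>\<sigma> (i + 1)\<close> is attached to the first node on
  \<open>tree_path \<sigma> i\<close> that is smaller than \<open>\<sigma> (i + 1)\<close>; its own path to the root is then
  \<open>\<sigma> (i + 1)\<close> followed by the path from that node. Attaching further nodes does not
  change existing paths.
\<close>

fun tree_path :: "(nat \<Rightarrow> nat) \<Rightarrow> nat \<Rightarrow> nat list" where
  "tree_path \<sigma> 0 = [0]"
| "tree_path \<sigma> (Suc i) = \<sigma> (Suc i) # dropWhile (\<lambda>v. \<not> v < \<sigma> (Suc i)) (tree_path \<sigma> i)"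

text \<open>The parent of the node \<open>\<sigma> i\<close>, for \<open>i \<ge> 1\<close>.\<close>

definition tree_parent :: "(nat \<Rightarrow> nat) \<Rightarrow> nat \<Rightarrow> nat" where
  "tree_parent \<sigma> i = hd (dropWhile (\<lambda>v. \<not> v < \<sigma> i) (tree_path \<sigma> (i - 1)))"

definition tree_leaves :: "nat \<Rightarrow> (nat \<Rightarrow> nat) \<Rightarrow> nat set" where
  "tree_leaves n \<sigma> = {v \<in> {0..n}. \<not> (\<exists>i\<in>{1..n}. tree_parent \<sigma> i = v)}"

definition ascent_tops :: "nat \<Rightarrow> (nat \<Rightarrow> nat) \<Rightarrow> nat set" where
  "ascent_tops n \<sigma> = {i \<in> {2..n}. \<sigma> (i - 1) < \<sigma> i}"

end

theory Submission
  imports Defs "HOL-Number_Theory.Cong"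
begin

text \<open>
  The rotation adds \<open>1\<close> to every entry of the Lehmer code, the \<open>i\<close>-th one modulo \<open>n - i + 1\<close>.
  Hence \<open>n!\<close> is a common period, and a statistic is homomesic as soon as its sum over \<open>n!\<close>
  successive rotations does not depend on the starting point. By the Chinese remainder theorem this
  holds for statistics that depend only on code entries with pairwise coprime moduli, such as two
  adjacent ones. For three consecutive entries \<open>a, b, c\<close> the only obstruction is the parity of
  \<open>a + c\<close>, and it is harmless if the sum of \<open>(-1) ^ (a + c)\<close> times the statistic over all
  permutations vanishes. For the up-down shape of three consecutive positions (hence for peaks) and
  for descents of distance \<open>2\<close> this follows from sign-reversing involutions. Every statistic of the
  theorem is a linear combination of such functions.
\<close>

section \<open>Homomesy\<close>

lemma orbit_subset_if_bij_betw:
  assumes "bij_betw X S S" "x \<in> S"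
  shows "orbit X x \<subseteq> S"
proof
  fix y assume "y \<in> orbit X x"
  then show "y \<in> S"
    by (induction rule: orbit.induct) (use assms in \<open>auto simp: bij_betw_def\<close>)
qed

lemma homomesic_cong:
  assumes "\<And>x. x \<in> S \<Longrightarrow> f x = g x"
  shows "homomesic S X f \<longleftrightarrow> homomesic S X g"
proof -
  have "c_mesic S X f c \<longleftrightarrow> c_mesic S X g c" for c
  proof (cases "bij_betw X S S")
    case True
    then have "(\<Sum>y\<in>orbit X x. real_of_int (f y)) = (\<Sum>y\<in>orbit X x. real_of_int (g y))"
      if "x \<in> S" for x
      using orbit_subset_if_bij_betw[OF True that] assms by (intro sum.cong) auto
    then show ?thesis
      by (simp add: c_mesic_def)
  qed (simp add: c_mesic_def)
  then show ?thesis
    by (simp add: homomesic_def)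
qed

lemma homomesic_const:
  assumes "finite S" "bij_betw X S S"
  shows "homomesic S X (\<lambda>_. c)"
proof -
  have "card (orbit X x) \<noteq> 0" if "x \<in> S" for x
    using orbit_subset_if_bij_betw[OF assms(2) that] assms(1) orbit_nonempty[of X x]
    by (auto dest: finite_subset)
  then have "c_mesic S X (\<lambda>_. c) (real_of_int c)"
    using assms by (simp add: c_mesic_def)
  then show ?thesis
    unfolding homomesic_def ..
qed

lemma homomesic_add:
  assumes "homomesic S X f" "homomesic S X g"
  shows "homomesic S X (\<lambda>x. f x + g x)"
proof -
  obtain c d where "c_mesic S X f c" "c_mesic S X g d"
    using assms unfolding homomesic_def by blast
  then have "c_mesic S X (\<lambda>x. f x + g x) (c + d)"
    by (simp add: c_mesic_def sum.distrib add_divide_distrib)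
  then show ?thesis
    unfolding homomesic_def ..
qed

lemma homomesic_cmult:
  assumes "homomesic S X f"
  shows "homomesic S X (\<lambda>x. k * f x)"
proof -
  obtain c where "c_mesic S X f c"
    using assms unfolding homomesic_def ..
  then have "c_mesic S X (\<lambda>x. k * f x) (k * c)"
    by (simp add: c_mesic_def sum_distrib_left[symmetric] times_divide_eq_right[symmetric]
        del: times_divide_eq_right)
  then show ?thesis
    unfolding homomesic_def ..
qed

lemma homomesic_diff:
  assumes "homomesic S X f" "homomesic S X g"
  shows "homomesic S X (\<lambda>x. f x - g x)"
  using homomesic_add[OF assms(1) homomesic_cmult[OF assms(2), of "- 1"]] by simp

lemma homomesic_sum:
  assumes "finite S" "bij_betw X S S" "\<And>i. i \<in> A \<Longrightarrow> homomesic S X (f i)"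
  shows "homomesic S X (\<lambda>x. \<Sum>i\<in>A. f i x)"
  using assms(3)
  by (induction A rule: infinite_finite_induct)
    (auto intro: homomesic_const[OF assms(1,2)] homomesic_add)

definition iterate_sum :: "('a \<Rightarrow> 'a) \<Rightarrow> nat \<Rightarrow> ('a \<Rightarrow> int) \<Rightarrow> 'a \<Rightarrow> int" where
  "iterate_sum X N f x = (\<Sum>t<N. f ((X ^^ t) x))"

lemma iterate_sum_funpow:
  assumes "(X ^^ N) x = x"
  shows "iterate_sum X N f ((X ^^ s) x) = iterate_sum X N f x"
proof (induction s)
  case (Suc s)
  let ?y = "(X ^^ s) x"
  have "(X ^^ N) ?y = (X ^^ s) ((X ^^ N) x)"
    by (metis add.commute funpow_add comp_apply)
  then have y: "(X ^^ N) ?y = ?y"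
    using assms by simp
  have "iterate_sum X N f (X ?y) + f ?y = (\<Sum>t<Suc N. f ((X ^^ t) ?y))"
    unfolding iterate_sum_def sum.lessThan_Suc_shift by (simp add: funpow_swap1)
  also have "\<dots> = iterate_sum X N f ?y + f ?y"
    using y by (simp add: iterate_sum_def)
  finally show ?case
    using Suc.IH by simp
qed simp

text \<open>
  Summing the hypothesis over an orbit \<open>O\<close> and exchanging the two sums gives
  \<open>card O * C = N * (\<Sum>y\<in>O. f y)\<close>.
\<close>

lemma homomesic_if_iterate_sum_const:
  assumes fin: "finite S" and bij: "bij_betw X S S" and N: "N > 0"
    and const: "\<And>x. x \<in> S \<Longrightarrow> iterate_sum X N f x = C"
  shows "homomesic S X f"
  unfolding homomesic_def c_mesic_def
proof (intro exI[of _ "real_of_int C / real N"] conjI ballI fin bij)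
  fix x assume x: "x \<in> S"
  let ?O = "orbit X x"
  have sub: "?O \<subseteq> S"
    by (rule orbit_subset_if_bij_betw[OF bij x])
  then have finO: "finite ?O"
    using fin finite_subset by blast
  have "bij_betw X ?O ?O"
    using endo_inj_surj[OF finO] bij sub
    by (auto simp: bij_betw_def intro: orbit.intros inj_on_subset)
  then have pow: "bij_betw (X ^^ t) ?O ?O" for t
    by (rule bij_betw_funpow)
  have "(\<Sum>y\<in>?O. C) = (\<Sum>y\<in>?O. \<Sum>t<N. f ((X ^^ t) y))"
    using sub const by (intro sum.cong) (auto simp: iterate_sum_def)
  also have "\<dots> = (\<Sum>t<N. \<Sum>y\<in>?O. f ((X ^^ t) y))"
    by (rule sum.swap)
  also have "\<dots> = (\<Sum>t<N. \<Sum>y\<in>?O. f y)"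
    by (intro sum.cong refl sum.reindex_bij_betw pow)
  finally have "int (card ?O) * C = int N * (\<Sum>y\<in>?O. f y)"
    by simp
  then have "real (card ?O) * real_of_int C = real N * (\<Sum>y\<in>?O. real_of_int (f y))"
    by (metis of_int_mult of_int_of_nat_eq of_int_sum)
  then show "(\<Sum>y\<in>?O. real_of_int (f y)) / real (card ?O) = real_of_int C / real N"
    using N finO orbit_nonempty[of X x] by (simp add: field_simps)
qed

lemma sum_invariant_times_iterate_sum:
  assumes bij: "bij_betw X S S" and inv: "\<And>x. x \<in> S \<Longrightarrow> s (X x) = s x"
  shows "(\<Sum>x\<in>S. s x * iterate_sum X N f x) = int N * (\<Sum>x\<in>S. s x * f x)"
proof -
  have "(X ^^ t) x \<in> S \<and> s ((X ^^ t) x) = s x" if "x \<in> S" for t x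
    using that bij inv by (induction t) (auto simp: bij_betw_apply)
  then have "(\<Sum>x\<in>S. s x * iterate_sum X N f x) =
      (\<Sum>x\<in>S. \<Sum>t<N. s ((X ^^ t) x) * f ((X ^^ t) x))"
    by (simp add: iterate_sum_def sum_distrib_left)
  also have "\<dots> = (\<Sum>t<N. \<Sum>x\<in>S. s ((X ^^ t) x) * f ((X ^^ t) x))"
    by (rule sum.swap)
  also have "\<dots> = (\<Sum>t<N. \<Sum>x\<in>S. s x * f x)"
    by (intro sum.cong refl sum.reindex_bij_betw[OF bij_betw_funpow[OF bij], of "\<lambda>y. s y * f y"])
  finally show ?thesis
    by simp
qed

text \<open>
  If an invariant sign \<open>s\<close> determines the iterate sums, these have the form \<open>A + s * B\<close>
  up to a factor \<open>2\<close>, and pairing with \<open>s\<close> shows \<open>B = 0\<close>.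
\<close>

lemma homomesic_if_sign_classes:
  assumes fin: "finite S" and bij: "bij_betw X S S" and N: "N > 0"
    and sign: "\<And>x. x \<in> S \<Longrightarrow> s x \<in> {1, - 1}"
    and inv: "\<And>x. x \<in> S \<Longrightarrow> s (X x) = s x"
    and determined: "\<And>x y. x \<in> S \<Longrightarrow> y \<in> S \<Longrightarrow> s x = s y \<Longrightarrow>
      iterate_sum X N f x = iterate_sum X N f y"
    and sum_s: "(\<Sum>x\<in>S. s x) = 0" and sum_sf: "(\<Sum>x\<in>S. s x * f x) = 0"
  shows "homomesic S X f"
proof -
  define F where "F = (\<lambda>\<epsilon>. iterate_sum X N f (SOME x. x \<in> S \<and> s x = \<epsilon>))"
  have F: "iterate_sum X N f x = F (s x)" if "x \<in> S" for x
    unfolding F_def using someI[of "\<lambda>y. y \<in> S \<and> s y = s x" x] that by (intro determined) auto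
  have "2 * (s x * iterate_sum X N f x) = (F 1 + F (- 1)) * s x + (F 1 - F (- 1))" if "x \<in> S" for x
    using F[OF that] sign[OF that] by auto
  then have "2 * (\<Sum>x\<in>S. s x * iterate_sum X N f x) =
      (\<Sum>x\<in>S. (F 1 + F (- 1)) * s x + (F 1 - F (- 1)))"
    unfolding sum_distrib_left by (intro sum.cong) auto
  also have "\<dots> = int (card S) * (F 1 - F (- 1))"
    by (simp add: sum.distrib sum_distrib_left[symmetric] sum_s)
  finally have "int (card S) * (F 1 - F (- 1)) = 0"
    by (simp add: sum_invariant_times_iterate_sum[where s = s, OF bij inv] sum_sf)
  then have "iterate_sum X N f x = F 1" if "x \<in> S" for x
    using that F[OF that] sign[OF that] fin by auto
  then show ?thesis
    by (rule homomesic_if_iterate_sum_const[OF fin bij N])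
qed

lemma bij_betw_if_funpow_eq_id:
  assumes "N > 0" "X ` S \<subseteq> S" "\<And>x. x \<in> S \<Longrightarrow> (X ^^ N) x = x"
  shows "bij_betw X S S"
proof (rule bij_betw_byWitness[where f' = "X ^^ (N - 1)"])
  have N: "N = Suc (N - 1)"
    using assms(1) by simp
  show "\<forall>x\<in>S. (X ^^ (N - 1)) (X x) = x" "\<forall>x\<in>S. X ((X ^^ (N - 1)) x) = x"
    using assms(3) N by (metis funpow_swap1 funpow_simps_right(2) comp_apply)+
  have "(X ^^ t) ` S \<subseteq> S" for t
    using assms(2) by (induction t) auto
  then show "(X ^^ (N - 1)) ` S \<subseteq> S" .
qed (rule assms(2))

section \<open>The Lehmer code\<close>

lemma less_iff_card_less:
  fixes f :: "'a \<Rightarrow> 'b::linorder"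
  assumes "finite K" "k \<in> K"
  shows "f k < x \<longleftrightarrow> card {j \<in> K. f j < f k} < card {j \<in> K. f j < x}"
proof (cases "f k < x")
  case True
  then have "{j \<in> K. f j < f k} \<subset> {j \<in> K. f j < x}"
    using assms by auto
  then show ?thesis
    using True assms by (simp add: psubset_card_mono)
next
  case False
  then have "card {j \<in> K. f j < x} \<le> card {j \<in> K. f j < f k}"
    using assms by (intro card_mono) auto
  then show ?thesis
    using False by simp
qed

lemma finite_Sym: "finite (Sym n)"
  unfolding Sym_def by (simp add: finite_permutations)

lemma Sym_inj: "\<sigma> \<in> Sym n \<Longrightarrow> inj \<sigma>"
  by (simp add: Sym_def permutes_inj)

lemma Sym_inj_on: "\<sigma> \<in> Sym n \<Longrightarrow> inj_on \<sigma> A"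
  using Sym_inj inj_on_subset by blast

lemma Sym_eq_iff: "\<sigma> \<in> Sym n \<Longrightarrow> \<sigma> i = \<sigma> j \<longleftrightarrow> i = j"
  by (simp add: inj_eq Sym_inj)

lemma Sym_not_less_iff: "\<sigma> \<in> Sym n \<Longrightarrow> i \<noteq> j \<Longrightarrow> \<not> \<sigma> i < \<sigma> j \<longleftrightarrow> \<sigma> j < \<sigma> i"
  using Sym_eq_iff[of \<sigma> n i j] by linarith

lemma Sym_in_iff: "\<sigma> \<in> Sym n \<Longrightarrow> \<sigma> i \<in> {1..n} \<longleftrightarrow> i \<in> {1..n}"
  unfolding Sym_def by (metis mem_Collect_eq permutes_in_image)

lemma Sym_image: "\<sigma> \<in> Sym n \<Longrightarrow> \<sigma> ` {1..n} = {1..n}"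
  unfolding Sym_def by (simp add: permutes_image)

lemma lehmer_code_le: "lehmer_code n \<sigma> i \<le> n - i"
proof -
  have "lehmer_code n \<sigma> i \<le> card {i<..n}"
    unfolding lehmer_code_def by (intro card_mono) auto
  then show ?thesis by simp
qed

lemma lehmer_code_eq_card_values:
  assumes \<sigma>: "\<sigma> \<in> Sym n" and i: "1 \<le> i"
  shows "lehmer_code n \<sigma> i = card {v \<in> {1..n} - \<sigma> ` {1..<i}. v < \<sigma> i}"
proof -
  have "{1..n} - \<sigma> ` {1..<i} = \<sigma> ` ({1..n} - {1..<i})"
    using image_set_diff[OF Sym_inj[OF \<sigma>]] Sym_image[OF \<sigma>] by metis
  moreover have "{1..n} - {1..<i} = {i..n}"
    using i by auto
  ultimately have "{v \<in> {1..n} - \<sigma> ` {1..<i}. v < \<sigma> i} = \<sigma> ` {j \<in> {i<..n}. \<sigma> j < \<sigma> i}"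
    by (force simp: le_less)
  then show ?thesis
    unfolding lehmer_code_def by (simp add: card_image[OF Sym_inj_on[OF \<sigma>]])
qed

lemma lehmer_code_less_iff:
  assumes \<sigma>: "\<sigma> \<in> Sym n" and \<tau>: "\<tau> \<in> Sym n" and i: "i \<in> {1..n}"
    and eq: "\<And>j. j \<in> {1..<i} \<Longrightarrow> \<sigma> j = \<tau> j"
  shows "lehmer_code n \<sigma> i < lehmer_code n \<tau> i \<longleftrightarrow> \<sigma> i < \<tau> i"
proof -
  define V where "V = {1..n} - \<sigma> ` {1..<i}"
  have V: "V = {1..n} - \<tau> ` {1..<i}"
    unfolding V_def by (intro arg_cong2[where f = minus] image_cong refl eq)
  have "\<sigma> i \<in> V"
    using Sym_in_iff[OF \<sigma>, of i] i by (auto simp: V_def Sym_eq_iff[OF \<sigma>])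
  then have "\<sigma> i < \<tau> i \<longleftrightarrow> card {v \<in> V. v < \<sigma> i} < card {v \<in> V. v < \<tau> i}"
    by (intro less_iff_card_less) (simp_all add: V_def)
  moreover have "lehmer_code n \<sigma> i = card {v \<in> V. v < \<sigma> i}"
    unfolding V_def using i by (intro lehmer_code_eq_card_values \<sigma>) simp
  moreover have "lehmer_code n \<tau> i = card {v \<in> V. v < \<tau> i}"
    unfolding V using i by (intro lehmer_code_eq_card_values \<tau>) simp
  ultimately show ?thesis
    by simp
qed

lemma lehmer_code_prefix_eq_iff:
  assumes \<sigma>: "\<sigma> \<in> Sym n" and \<tau>: "\<tau> \<in> Sym n" and "i \<le> n + 1"
  shows "(\<forall>j\<in>{1..<i}. lehmer_code n \<sigma> j = lehmer_code n \<tau> j) \<longleftrightarrow> (\<forall>j\<in>{1..<i}. \<sigma> j = \<tau> j)"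
  using assms(3)
proof (induction i)
  case (Suc i)
  show ?case
  proof (cases "i = 0")
    case False
    then have i: "i \<in> {1..n}"
      using Suc.prems by simp
    have "lehmer_code n \<sigma> i = lehmer_code n \<tau> i \<longleftrightarrow> \<sigma> i = \<tau> i" if "\<forall>j\<in>{1..<i}. \<sigma> j = \<tau> j"
      using lehmer_code_less_iff[OF \<sigma> \<tau> i] lehmer_code_less_iff[OF \<tau> \<sigma> i] that
      by (metis linorder_neq_iff)
    moreover have "{1..<Suc i} = insert i {1..<i}"
      using False by auto
    ultimately show ?thesis
      using Suc by auto
  qed simp
qed simp

lemma lehmer_code_inject:
  assumes \<sigma>: "\<sigma> \<in> Sym n" and \<tau>: "\<tau> \<in> Sym n"
    and "\<And>i. i \<in> {1..n} \<Longrightarrow> lehmer_code n \<sigma> i = lehmer_code n \<tau> i"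
  shows "\<sigma> = \<tau>"
proof
  fix j
  show "\<sigma> j = \<tau> j"
  proof (cases "j \<in> {1..n}")
    case True
    then show ?thesis
      using lehmer_code_prefix_eq_iff[OF \<sigma> \<tau>, of "n + 1"] assms(3) by auto
  next
    case False
    then show ?thesis
      using \<sigma> \<tau> by (simp add: Sym_def permutes_not_in)
  qed
qed

definition codewords :: "nat \<Rightarrow> (nat \<Rightarrow> nat) set" where
  "codewords n = (\<Pi>\<^sub>E i\<in>{1..n}. {..n - i})"

definition codeword :: "nat \<Rightarrow> (nat \<Rightarrow> nat) \<Rightarrow> nat \<Rightarrow> nat" where
  "codeword n \<sigma> = restrict (lehmer_code n \<sigma>) {1..n}"

lemma codeword_apply [simp]: "i \<in> {1..n} \<Longrightarrow> codeword n \<sigma> i = lehmer_code n \<sigma> i"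
  by (simp add: codeword_def)

lemma bij_betw_codeword: "bij_betw (codeword n) (Sym n) (codewords n)"
proof -
  have inj: "inj_on (codeword n) (Sym n)"
    by (intro inj_onI lehmer_code_inject) (assumption+, metis codeword_apply)
  have "card (codewords n) = (\<Prod>i=1..n. Suc (n - i))"
    by (simp add: codewords_def card_PiE)
  also have "\<dots> = (\<Prod>i=1..n. i)"
    by (rule prod.reindex_bij_witness[of _ "\<lambda>i. Suc (n - i)" "\<lambda>i. Suc (n - i)"]) auto
  also have "\<dots> = card (Sym n)"
    unfolding Sym_def by (simp add: card_permutations fact_prod)
  finally have "card (codeword n ` Sym n) = card (codewords n)"
    by (simp only: card_image[OF inj])
  moreover have "codeword n ` Sym n \<subseteq> codewords n"
    by (auto simp: codeword_def codewords_def lehmer_code_le)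
  moreover have "finite (codewords n)"
    by (simp add: codewords_def finite_PiE)
  ultimately show ?thesis
    using inj by (simp add: bij_betw_def card_subset_eq)
qed

lemma ex1_lehmer_code:
  assumes "\<And>i. i \<in> {1..n} \<Longrightarrow> c i \<le> n - i"
  shows "\<exists>!\<tau>. \<tau> \<in> Sym n \<and> (\<forall>i\<in>{1..n}. lehmer_code n \<tau> i = c i)"
proof (rule ex_ex1I)
  have "restrict c {1..n} \<in> codewords n"
    using assms by (auto simp: codewords_def)
  then obtain \<tau> where "\<tau> \<in> Sym n" "codeword n \<tau> = restrict c {1..n}"
    using bij_betw_codeword[of n] by (metis bij_betw_iff_bijections)
  then show "\<exists>\<tau>. \<tau> \<in> Sym n \<and> (\<forall>i\<in>{1..n}. lehmer_code n \<tau> i = c i)"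
    by (metis codeword_apply restrict_apply')
qed (auto intro: lehmer_code_inject)

section \<open>The Lehmer code rotation\<close>

lemma
  shows lehmer_rotation_in_Sym: "lehmer_rotation n \<sigma> \<in> Sym n"
    and lehmer_code_rotation: "i \<in> {1..n} \<Longrightarrow>
      lehmer_code n (lehmer_rotation n \<sigma>) i = (lehmer_code n \<sigma> i + 1) mod (n - i + 1)"
proof -
  have "(lehmer_code n \<sigma> i + 1) mod (n - i + 1) \<le> n - i" for i
    using mod_less_divisor[of "n - i + 1" "lehmer_code n \<sigma> i + 1"] by linarith
  from theI'[OF ex1_lehmer_code[OF this]]
  show "lehmer_rotation n \<sigma> \<in> Sym n"
    and "i \<in> {1..n} \<Longrightarrow>
      lehmer_code n (lehmer_rotation n \<sigma>) i = (lehmer_code n \<sigma> i + 1) mod (n - i + 1)"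
    unfolding lehmer_rotation_def by blast+
qed

lemma funpow_lehmer_rotation_in_Sym:
  "\<sigma> \<in> Sym n \<Longrightarrow> (lehmer_rotation n ^^ t) \<sigma> \<in> Sym n"
  by (induction t) (auto simp: lehmer_rotation_in_Sym)

lemma lehmer_code_funpow_rotation:
  assumes "i \<in> {1..n}"
  shows "lehmer_code n ((lehmer_rotation n ^^ t) \<sigma>) i = (lehmer_code n \<sigma> i + t) mod (n - i + 1)"
proof (induction t)
  case 0
  show ?case
    using lehmer_code_le[of n \<sigma> i] by simp
qed (use assms in \<open>simp add: lehmer_code_rotation mod_Suc_eq\<close>)

lemma funpow_fact_lehmer_rotation:
  assumes \<sigma>: "\<sigma> \<in> Sym n"
  shows "(lehmer_rotation n ^^ fact n) \<sigma> = \<sigma>"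
proof (rule lehmer_code_inject[OF funpow_lehmer_rotation_in_Sym[OF \<sigma>] \<sigma>])
  fix i assume i: "i \<in> {1..n}"
  have "n - i + 1 dvd fact n"
    using i by (intro dvd_fact) auto
  then have "(lehmer_code n \<sigma> i + fact n) mod (n - i + 1) = lehmer_code n \<sigma> i mod (n - i + 1)"
    by (metis add.right_neutral dvd_imp_mod_0 mod_add_right_eq)
  also have "\<dots> = lehmer_code n \<sigma> i"
    using lehmer_code_le[of n \<sigma> i] by simp
  finally have "(lehmer_code n \<sigma> i + fact n) mod (n - i + 1) = lehmer_code n \<sigma> i" .
  then show "lehmer_code n ((lehmer_rotation n ^^ fact n) \<sigma>) i = lehmer_code n \<sigma> i"
    by (simp only: lehmer_code_funpow_rotation[OF i])
qed

lemma bij_betw_lehmer_rotation: "bij_betw (lehmer_rotation n) (Sym n) (Sym n)"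
  by (rule bij_betw_if_funpow_eq_id[of "fact n"])
    (auto simp: lehmer_rotation_in_Sym funpow_fact_lehmer_rotation)

abbreviation (input) lehmer_mesic :: "nat \<Rightarrow> ((nat \<Rightarrow> nat) \<Rightarrow> int) \<Rightarrow> bool" where
  "lehmer_mesic n \<equiv> homomesic (Sym n) (lehmer_rotation n)"

lemma lehmer_mesic_const: "lehmer_mesic n (\<lambda>_. c)"
  by (rule homomesic_const[OF finite_Sym bij_betw_lehmer_rotation])

lemma lehmer_mesic_sum:
  "(\<And>i. i \<in> A \<Longrightarrow> lehmer_mesic n (f i)) \<Longrightarrow> lehmer_mesic n (\<lambda>\<sigma>. \<Sum>i\<in>A. f i \<sigma>)"
  by (rule homomesic_sum[OF finite_Sym bij_betw_lehmer_rotation])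

section \<open>Statistics depending on few code entries\<close>

definition depends_on_code :: "nat \<Rightarrow> nat set \<Rightarrow> ((nat \<Rightarrow> nat) \<Rightarrow> 'a) \<Rightarrow> bool" where
  "depends_on_code n I f \<longleftrightarrow> (\<forall>\<sigma>\<in>Sym n. \<forall>\<tau>\<in>Sym n.
     (\<forall>i\<in>I. lehmer_code n \<sigma> i = lehmer_code n \<tau> i) \<longrightarrow> f \<sigma> = f \<tau>)"

lemma depends_on_code_lehmer_code: "i \<in> I \<Longrightarrow> depends_on_code n I (\<lambda>\<sigma>. lehmer_code n \<sigma> i)"
  by (simp add: depends_on_code_def)

lemma depends_on_code_comp:
  assumes "depends_on_code n I f"
  shows "depends_on_code n I (\<lambda>\<sigma>. g (f \<sigma>))"
  using assms unfolding depends_on_code_def by (intro ballI impI arg_cong[of _ _ g]) blast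

lemma depends_on_code_comp2:
  assumes "depends_on_code n I f" "depends_on_code n I g"
  shows "depends_on_code n I (\<lambda>\<sigma>. h (f \<sigma>) (g \<sigma>))"
  using assms unfolding depends_on_code_def by (intro ballI impI arg_cong2[of _ _ _ _ h]) blast+

text \<open>
  Modulo \<open>n - i + 1\<close>, the number \<open>lehmer_code n \<tau> i + (n - i) * lehmer_code n \<sigma> i\<close> is the
  difference of the two code entries.
\<close>

lemma iterate_sum_lehmer_rotation_eq:
  assumes dep: "depends_on_code n I f" and I: "I \<subseteq> {1..n}"
    and \<sigma>: "\<sigma> \<in> Sym n" and \<tau>: "\<tau> \<in> Sym n"
    and s: "\<And>i. i \<in> I \<Longrightarrow>
      [s = lehmer_code n \<tau> i + (n - i) * lehmer_code n \<sigma> i] (mod (n - i + 1))"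
  shows "iterate_sum (lehmer_rotation n) (fact n) f \<sigma> =
    iterate_sum (lehmer_rotation n) (fact n) f \<tau>"
proof -
  let ?\<sigma>' = "(lehmer_rotation n ^^ s) \<sigma>"
  have code: "lehmer_code n ?\<sigma>' i = lehmer_code n \<tau> i" if i: "i \<in> I" for i
  proof -
    let ?a = "lehmer_code n \<sigma> i" and ?b = "lehmer_code n \<tau> i" and ?m = "n - i + 1"
    have "[?a + s = ?a + (?b + (n - i) * ?a)] (mod ?m)"
      using s[OF i] by (simp only: cong_add_lcancel_nat)
    moreover have "?a + (?b + (n - i) * ?a) = ?b + ?m * ?a"
      by (simp add: algebra_simps)
    ultimately have "(?a + s) mod ?m = ?b mod ?m"
      by (metis cong_def mod_mult_self2)
    then show ?thesis
      using lehmer_code_funpow_rotation[of i n s \<sigma>] lehmer_code_le[of n \<tau> i] I i by auto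
  qed
  have "f ((lehmer_rotation n ^^ t) ?\<sigma>') = f ((lehmer_rotation n ^^ t) \<tau>)" for t
  proof -
    have "lehmer_code n ((lehmer_rotation n ^^ t) ?\<sigma>') i =
        lehmer_code n ((lehmer_rotation n ^^ t) \<tau>) i"
      if "i \<in> I" for i
      using I that code[OF that] by (simp only: lehmer_code_funpow_rotation subset_iff)
    then show ?thesis
      using dep \<sigma> \<tau> by (simp add: depends_on_code_def funpow_lehmer_rotation_in_Sym)
  qed
  then have "iterate_sum (lehmer_rotation n) (fact n) f ?\<sigma>' =
      iterate_sum (lehmer_rotation n) (fact n) f \<tau>"
    by (simp add: iterate_sum_def)
  then show ?thesis
    by (simp only: iterate_sum_funpow[OF funpow_fact_lehmer_rotation[OF \<sigma>]])
qed

lemma lehmer_mesic_if_coprime_moduli: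
  assumes I: "I \<subseteq> {1..n}"
    and coprime: "\<And>i j. i \<in> I \<Longrightarrow> j \<in> I \<Longrightarrow> i < j \<Longrightarrow> coprime (n - i + 1) (n - j + 1)"
    and dep: "depends_on_code n I f"
  shows "lehmer_mesic n f"
proof (rule homomesic_if_iterate_sum_const[OF finite_Sym bij_betw_lehmer_rotation fact_gt_zero])
  fix \<sigma> assume \<sigma>: "\<sigma> \<in> Sym n"
  have id: "id \<in> Sym n"
    by (simp add: Sym_def permutes_id)
  have "coprime (n - i + 1) (n - j + 1)" if "i \<in> I" "j \<in> I" "i \<noteq> j" for i j
    using that coprime[of i j] coprime[of j i] by (metis coprime_commute linorder_neqE_nat)
  moreover have "finite I"
    using I finite_subset by blast
  ultimately obtain s where
    "\<forall>i\<in>I. [s = lehmer_code n id i + (n - i) * lehmer_code n \<sigma> i] (mod (n - i + 1))"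
    using chinese_remainder_nat[of I "\<lambda>i. n - i + 1"
        "\<lambda>i. lehmer_code n id i + (n - i) * lehmer_code n \<sigma> i"] by blast
  then show "iterate_sum (lehmer_rotation n) (fact n) f \<sigma> =
      iterate_sum (lehmer_rotation n) (fact n) f id"
    by (intro iterate_sum_lehmer_rotation_eq[OF dep I \<sigma> id]) auto
qed

lemma lehmer_mesic_if_code_entry:
  assumes "i \<in> {1..n}" "depends_on_code n {i} f"
  shows "lehmer_mesic n f"
  using assms by (intro lehmer_mesic_if_coprime_moduli[of "{i}"]) auto

lemma lehmer_mesic_if_adjacent_code_entries:
  assumes "1 \<le> i" "i < n" "depends_on_code n {i, i + 1} f"
  shows "lehmer_mesic n f"
proof (rule lehmer_mesic_if_coprime_moduli[of "{i, i + 1}"])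
  have "n - i + 1 = Suc (n - (i + 1) + 1)"
    using assms by simp
  then have "coprime (n - i + 1) (n - (i + 1) + 1)"
    by (simp only: coprime_Suc_left_nat)
  then show "coprime (n - j + 1) (n - k + 1)" if "j \<in> {i, i + 1}" "k \<in> {i, i + 1}" "j < k" for j k
    using that by auto
qed (use assms in auto)

section \<open>Three consecutive code entries\<close>

lemma chinese_remainder_three_consecutive:
  fixes m a b c :: nat
  assumes "even m" "even (a + c)"
  shows "\<exists>s. [s = a] (mod (m + 2)) \<and> [s = b] (mod (m + 1)) \<and> [s = c] (mod m)"
proof -
  have "even (c + (m + 1) * a)"
    using assms by auto
  then obtain k where k: "c + (m + 1) * a = 2 * k" ..
  define s0 where "s0 = c + m * k"
  have "s0 + (m + 2) * a = a + (m + 2) * k"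
    using k by (simp add: s0_def algebra_simps)
  then have s0: "[s0 = a] (mod (m + 2))" "[s0 = c] (mod m)"
    by (metis cong_def mod_mult_self2, simp add: s0_def cong_def)
  have "coprime (m + 2) (m + 1)" "coprime m (m + 1)"
    using coprime_Suc_left_nat[of "m + 1"] coprime_Suc_right_nat[of m] by simp_all
  then have "coprime ((m + 2) * m) (m + 1)"
    by (simp only: coprime_mult_left_iff)
  then obtain s where s: "[s = s0] (mod ((m + 2) * m))" "[s = b] (mod (m + 1))"
    using binary_chinese_remainder_nat by blast
  have "[s = s0] (mod (m + 2))" "[s = s0] (mod m)"
    using s(1) cong_modulus_mult_nat by (blast, metis mult.commute cong_modulus_mult_nat)
  then show ?thesis
    using s(2) s0 cong_trans by blast
qed

definition outer_sign :: "nat \<Rightarrow> (nat \<Rightarrow> nat) \<Rightarrow> int" where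
  "outer_sign i c = (- 1) ^ (c i + c (i + 2))"

definition toggle :: "nat \<Rightarrow> nat" where
  "toggle x = (if even x then x + 1 else x - 1)"

lemma toggle_toggle: "toggle (toggle x) = x"
  by (simp add: toggle_def)

lemma even_toggle_iff: "even (toggle x) \<longleftrightarrow> odd x"
  by (simp add: toggle_def)

lemma toggle_le_iff: "odd b \<Longrightarrow> toggle a \<le> b \<longleftrightarrow> a \<le> b"
  by (auto simp: toggle_def elim!: evenE oddE)

lemma toggle_less_iff: "even b \<Longrightarrow> toggle a < b \<longleftrightarrow> a < b"
  by (auto simp: toggle_def elim!: evenE oddE)

lemma codewords_upd:
  "c \<in> codewords n \<Longrightarrow> j \<in> {1..n} \<Longrightarrow> v \<le> n - j \<Longrightarrow> c(j := v) \<in> codewords n"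
  by (auto simp: codewords_def PiE_def extensional_def Pi_def)

lemma codewords_le: "c \<in> codewords n \<Longrightarrow> j \<in> {1..n} \<Longrightarrow> c j \<le> n - j"
  by (auto simp: codewords_def)

lemma sum_codeword_eq_0_if_involution:
  fixes h :: "(nat \<Rightarrow> nat) \<Rightarrow> int"
  assumes "\<And>c. c \<in> codewords n \<Longrightarrow> T c \<in> codewords n" "\<And>c. c \<in> codewords n \<Longrightarrow> T (T c) = c"
    and "\<And>c. c \<in> codewords n \<Longrightarrow> T c \<noteq> c" "\<And>c. c \<in> codewords n \<Longrightarrow> h (T c) + h c = 0"
  shows "(\<Sum>\<sigma>\<in>Sym n. h (codeword n \<sigma>)) = 0"
proof -
  have "(\<Sum>\<sigma>\<in>Sym n. h (codeword n \<sigma>)) = sum h (codewords n)"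
    by (rule sum.reindex_bij_betw[OF bij_betw_codeword])
  also have "\<dots> = 0"
    by (rule sum_involution_eq_0[of _ h T]) (use assms in auto)
  finally show ?thesis .
qed

text \<open>
  With \<open>a, b, c\<close> the code entries at \<open>i, i + 1, i + 2\<close>: toggling the last bit of \<open>a\<close> does not affect
  \<open>b < a\<close> if \<open>b\<close> is odd, and toggling that of \<open>c\<close> does not affect \<open>c < b\<close> if \<open>b\<close> is even.
  Either way the sign is reversed.
\<close>

lemma sum_outer_sign_times_shape:
  fixes g :: "bool \<Rightarrow> bool \<Rightarrow> int"
  assumes i: "1 \<le> i" "i + 2 \<le> n" and odd: "odd (n - i)"
  shows "(\<Sum>\<sigma>\<in>Sym n. outer_sign i (lehmer_code n \<sigma>) *
    g (lehmer_code n \<sigma> (i + 1) < lehmer_code n \<sigma> i)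
      (lehmer_code n \<sigma> (i + 2) < lehmer_code n \<sigma> (i + 1))) = 0"
proof -
  define h where "h = (\<lambda>c. outer_sign i c * g (c (i + 1) < c i) (c (i + 2) < c (i + 1)))"
  define T where "T = (\<lambda>c :: nat \<Rightarrow> nat.
    let j = if odd (c (i + 1)) then i else i + 2 in c(j := toggle (c j)))"
  have "odd (n - (i + 2))"
    using odd i by (simp add: diff_diff_add[symmetric])
  then have T_in: "T c \<in> codewords n" if "c \<in> codewords n" for c
    using odd i codewords_le[OF that, of i] codewords_le[OF that, of "i + 2"]
    by (auto simp: T_def toggle_le_iff intro!: codewords_upd that)
  have T_T: "T (T c) = c" for c
    by (auto simp: T_def Let_def toggle_toggle)
  have T_neq: "T c \<noteq> c" for c
    by (metis T_def even_toggle_iff fun_upd_same)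
  have h_T: "h (T c) + h c = 0" for c
    using toggle_le_iff[of "c (i + 1)" "c i"] toggle_less_iff[of "c (i + 1)" "c (i + 2)"]
    by (cases "odd (c (i + 1))")
      (auto simp: h_def T_def outer_sign_def minus_one_power_iff even_toggle_iff not_le[symmetric])
  have "(\<Sum>\<sigma>\<in>Sym n. h (codeword n \<sigma>)) = 0"
    by (intro sum_codeword_eq_0_if_involution[of n T] T_in T_T T_neq h_T)
  then show ?thesis
    using i by (simp add: h_def outer_sign_def)
qed

lemma outer_sign_lehmer_rotation:
  assumes i: "1 \<le> i" "i + 2 \<le> n" and odd: "odd (n - i)"
  shows "outer_sign i (lehmer_code n (lehmer_rotation n \<sigma>)) = outer_sign i (lehmer_code n \<sigma>)"
proof -
  have "even (lehmer_code n (lehmer_rotation n \<sigma>) j) \<longleftrightarrow> odd (lehmer_code n \<sigma> j)"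
    if "j \<in> {i, i + 2}" for j
  proof -
    have "even (n - j + 1)" "j \<in> {1..n}"
      using that i odd by (auto simp: diff_diff_add[symmetric])
    then show ?thesis
      by (simp add: lehmer_code_rotation dvd_mod_iff)
  qed
  then show ?thesis
    by (simp add: outer_sign_def minus_one_power_iff)
qed

text \<open>
  For odd \<open>n - i\<close> the outer moduli \<open>n - i + 1\<close> and \<open>n - i - 1\<close> are even, and parity is the only
  obstruction to a common time shift of the three entries.
\<close>

lemma iterate_sum_eq_if_outer_sign_eq:
  assumes i: "1 \<le> i" "i + 2 \<le> n" and odd: "odd (n - i)"
    and dep: "depends_on_code n {i, i + 1, i + 2} f"
    and \<sigma>: "\<sigma> \<in> Sym n" and \<tau>: "\<tau> \<in> Sym n"
    and sign: "outer_sign i (lehmer_code n \<sigma>) = outer_sign i (lehmer_code n \<tau>)"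
  shows "iterate_sum (lehmer_rotation n) (fact n) f \<sigma> =
    iterate_sum (lehmer_rotation n) (fact n) f \<tau>"
proof -
  define u where "u = (\<lambda>j. lehmer_code n \<tau> j + (n - j) * lehmer_code n \<sigma> j)"
  define m where "m = n - (i + 1)"
  have m: "n - i + 1 = m + 2" "n - (i + 1) + 1 = m + 1" "n - (i + 2) + 1 = m"
    using i by (auto simp: m_def)
  have "even m" "odd (n - (i + 2))"
    using i odd by (auto simp: m_def diff_diff_add[symmetric])
  moreover have "even (u i + u (i + 2))"
    using sign odd \<open>odd (n - (i + 2))\<close>
    by (simp add: u_def outer_sign_def minus_one_power_iff split: if_splits)
  ultimately obtain s where
    "[s = u i] (mod (m + 2))" "[s = u (i + 1)] (mod (m + 1))" "[s = u (i + 2)] (mod m)"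
    using chinese_remainder_three_consecutive by blast
  then have "[s = u j] (mod (n - j + 1))" if "j \<in> {i, i + 1, i + 2}" for j
    using that m by (elim insertE emptyE) (simp_all only:)
  moreover have "{i, i + 1, i + 2} \<subseteq> {1..n}"
    using i by auto
  ultimately show ?thesis
    unfolding u_def by (intro iterate_sum_lehmer_rotation_eq[OF dep _ \<sigma> \<tau>])
qed

lemma lehmer_mesic_if_three_code_entries:
  assumes i: "1 \<le> i" "i + 2 \<le> n" and dep: "depends_on_code n {i, i + 1, i + 2} f"
    and alt: "odd (n - i) \<Longrightarrow> (\<Sum>\<sigma>\<in>Sym n. outer_sign i (lehmer_code n \<sigma>) * f \<sigma>) = 0"
  shows "lehmer_mesic n f"
proof (cases "odd (n - i)")
  case odd: True
  have "(\<Sum>\<sigma>\<in>Sym n. outer_sign i (lehmer_code n \<sigma>)) = 0"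
    using sum_outer_sign_times_shape[OF i odd, of "\<lambda>_ _. 1"] by simp
  moreover have "outer_sign i c \<in> {1, - 1}" for c
    by (simp add: outer_sign_def minus_one_power_iff)
  ultimately show ?thesis
    using finite_Sym bij_betw_lehmer_rotation fact_gt_zero outer_sign_lehmer_rotation[OF i odd]
      iterate_sum_eq_if_outer_sign_eq[OF i odd dep] alt[OF odd]
    by (intro homomesic_if_sign_classes[where N = "fact n" and
          s = "\<lambda>\<sigma>. outer_sign i (lehmer_code n \<sigma>)"])
next
  case False
  define m where "m = n - (i + 1)"
  have m: "n - i + 1 = m + 2" "n - (i + 1) + 1 = m + 1" "n - (i + 2) + 1 = m" "odd m"
    using i False by (auto simp: m_def diff_diff_add[symmetric])
  then have "coprime (m + 2) m"
    by (metis add.commute coprime_iff_gcd_eq_1 gcd_add1 coprime_right_2_iff_odd coprime_commute)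
  moreover have "coprime (m + 2) (m + 1)" "coprime (m + 1) m"
    using coprime_Suc_left_nat[of "m + 1"] coprime_Suc_left_nat[of m] by simp_all
  ultimately have coprime: "coprime (n - j + 1) (n - k + 1)"
    if "j = i \<and> k = i + 1 \<or> j = i \<and> k = i + 2 \<or> j = i + 1 \<and> k = i + 2" for j k
    using that by (elim disjE conjE) (simp_all only: m)
  have "{i, i + 1, i + 2} \<subseteq> {1..n}"
    using i by auto
  then show ?thesis
    by (rule lehmer_mesic_if_coprime_moduli[OF _ coprime dep]) auto
qed

section \<open>Descents and peaks\<close>

lemma greaterThanAtMost_eq_insert: "i < n \<Longrightarrow> {i<..n} = insert (i + 1) {i + 1<..n}" for i n :: nat
  by auto

lemma descent_iff_lehmer_code:
  assumes "i < n"
  shows "\<sigma> (i + 1) < \<sigma> i \<longleftrightarrow> lehmer_code n \<sigma> (i + 1) < lehmer_code n \<sigma> i"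
proof -
  have "{j \<in> {i<..n}. \<sigma> j < \<sigma> (i + 1)} = {j \<in> {i + 1<..n}. \<sigma> j < \<sigma> (i + 1)}"
    using greaterThanAtMost_eq_insert[OF assms] by auto
  then show ?thesis
    using less_iff_card_less[of "{i<..n}" "i + 1" \<sigma>] assms by (simp add: lehmer_code_def)
qed

lemma depends_on_code_descent:
  assumes "i < n"
  shows "depends_on_code n {i, i + 1} (\<lambda>\<sigma>. \<sigma> (i + 1) < \<sigma> i)"
proof -
  have "(\<lambda>\<sigma>. \<sigma> (i + 1) < \<sigma> i) = (\<lambda>\<sigma>. lehmer_code n \<sigma> (i + 1) < lehmer_code n \<sigma> i)"
    using descent_iff_lehmer_code[OF assms] by blast
  moreover have "depends_on_code n {i, i + 1} \<dots>"
    by (rule depends_on_code_comp2[OF depends_on_code_lehmer_code depends_on_code_lehmer_code])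
      simp_all
  ultimately show ?thesis
    by (simp only:)
qed

lemma lehmer_mesic_card_filter:
  assumes "finite A" "\<And>i. i \<in> A \<Longrightarrow> lehmer_mesic n (\<lambda>\<sigma>. of_bool (P i \<sigma>))"
  shows "lehmer_mesic n (\<lambda>\<sigma>. int (card {i \<in> A. P i \<sigma>}))"
proof -
  have "int (card {i \<in> A. P i \<sigma>}) = (\<Sum>i\<in>A. of_bool (P i \<sigma>))" for \<sigma>
    using assms(1) by (simp add: Collect_conj_eq)
  then show ?thesis
    by (simp only:) (intro lehmer_mesic_sum assms(2))
qed

lemma lehmer_mesic_descent_at:
  fixes g :: "bool \<Rightarrow> int"
  assumes "1 \<le> i" "i < n"
  shows "lehmer_mesic n (\<lambda>\<sigma>. g (\<sigma> (i + 1) < \<sigma> i))"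
  using depends_on_code_comp[OF depends_on_code_descent[OF assms(2)]]
  by (rule lehmer_mesic_if_adjacent_code_entries[OF assms])

lemma lehmer_mesic_shape_at:
  fixes g :: "bool \<Rightarrow> bool \<Rightarrow> int"
  assumes i: "1 \<le> i" "i + 2 \<le> n"
  shows "lehmer_mesic n (\<lambda>\<sigma>. g (\<sigma> (i + 1) < \<sigma> i) (\<sigma> (i + 2) < \<sigma> (i + 1)))"
proof -
  have "\<sigma> (i + 2) < \<sigma> (i + 1) \<longleftrightarrow> lehmer_code n \<sigma> (i + 2) < lehmer_code n \<sigma> (i + 1)" for \<sigma>
    using descent_iff_lehmer_code[of "i + 1" n \<sigma>] i by simp
  moreover have "\<sigma> (i + 1) < \<sigma> i \<longleftrightarrow> lehmer_code n \<sigma> (i + 1) < lehmer_code n \<sigma> i" for \<sigma>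
    using i by (intro descent_iff_lehmer_code) simp
  ultimately have "(\<lambda>\<sigma>. g (\<sigma> (i + 1) < \<sigma> i) (\<sigma> (i + 2) < \<sigma> (i + 1))) =
      (\<lambda>\<sigma>. g (lehmer_code n \<sigma> (i + 1) < lehmer_code n \<sigma> i)
        (lehmer_code n \<sigma> (i + 2) < lehmer_code n \<sigma> (i + 1)))"
    by (intro ext arg_cong2[where f = g])
  moreover have "lehmer_mesic n \<dots>"
    by (rule lehmer_mesic_if_three_code_entries[OF i _ sum_outer_sign_times_shape[OF i]])
      (simp_all add: depends_on_code_def)
  ultimately show ?thesis
    by (simp only:)
qed

lemma lehmer_mesic_card_shape:
  "lehmer_mesic n (\<lambda>\<sigma>. int (card {i \<in> {1..<n - 1}. P (\<sigma> (i + 1) < \<sigma> i) (\<sigma> (i + 2) < \<sigma> (i + 1))}))"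
proof (rule lehmer_mesic_card_filter)
  fix i assume "i \<in> {1..<n - 1}"
  then show "lehmer_mesic n (\<lambda>\<sigma>. of_bool (P (\<sigma> (i + 1) < \<sigma> i) (\<sigma> (i + 2) < \<sigma> (i + 1))))"
    by (intro lehmer_mesic_shape_at[where g = "\<lambda>p q. of_bool (P p q)"]) auto
qed simp

lemma finite_descents: "finite (descents n \<sigma>)"
  by (simp add: descents_def)

lemma lehmer_mesic_sum_descents: "lehmer_mesic n (\<lambda>\<sigma>. \<Sum>i\<in>descents n \<sigma>. w i)"
proof -
  have "(\<Sum>i\<in>descents n \<sigma>. w i) = (\<Sum>i\<in>{1..<n}. if \<sigma> (i + 1) < \<sigma> i then w i else 0)" for \<sigma>
    unfolding descents_def by (rule sum.inter_filter) simp
  moreover have "lehmer_mesic n (\<lambda>\<sigma>. \<Sum>i\<in>{1..<n}. if \<sigma> (i + 1) < \<sigma> i then w i else 0)"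
    by (intro lehmer_mesic_sum lehmer_mesic_descent_at) auto
  ultimately show ?thesis
    by simp
qed

lemma lehmer_mesic_descents_filter: "lehmer_mesic n (\<lambda>\<sigma>. int (card {i \<in> descents n \<sigma>. P i}))"
  using lehmer_mesic_sum_descents[of n "\<lambda>i. of_bool (P i)"]
  by (simp add: Collect_conj_eq finite_descents)

lemma lehmer_mesic_descents: "lehmer_mesic n (\<lambda>\<sigma>. int (card (descents n \<sigma>)))"
  using lehmer_mesic_sum_descents[of n "\<lambda>_. 1"] by simp

lemma lehmer_mesic_major_index: "lehmer_mesic n (\<lambda>\<sigma>. int (major_index n \<sigma>))"
  using lehmer_mesic_sum_descents[of n int] by (simp add: major_index_def)

lemma lehmer_mesic_comajor_index: "lehmer_mesic n (\<lambda>\<sigma>. int (comajor_index n \<sigma>))"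
  using lehmer_mesic_sum_descents[of n "\<lambda>i. int (n - i)"] by (simp add: comajor_index_def)

lemma lehmer_mesic_in_descents: "lehmer_mesic n (\<lambda>\<sigma>. of_bool (i \<in> descents n \<sigma>))"
  using lehmer_mesic_sum_descents[of n "\<lambda>j. of_bool (j = i)"]
  by (simp add: of_bool_def sum.delta finite_descents)

lemma in_ascents_iff: "i \<in> ascents n \<sigma> \<longleftrightarrow> i \<in> {1..<n} \<and> \<not> \<sigma> (i + 1) < \<sigma> i"
  by (auto simp: ascents_def descents_def)

lemma in_descents_iff: "i \<in> descents n \<sigma> \<longleftrightarrow> i \<in> {1..<n} \<and> \<sigma> (i + 1) < \<sigma> i"
  by (simp add: descents_def)

lemma lehmer_mesic_ascents: "lehmer_mesic n (\<lambda>\<sigma>. int (card (ascents n \<sigma>)))"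
proof -
  have "ascents n \<sigma> = {i \<in> {1..<n}. \<not> \<sigma> (i + 1) < \<sigma> i}" for \<sigma>
    by (auto simp: in_ascents_iff)
  then show ?thesis
    using lehmer_mesic_card_filter[of "{1..<n}" n "\<lambda>i \<sigma>. \<not> \<sigma> (i + 1) < \<sigma> i"]
      lehmer_mesic_descent_at[of _ n "\<lambda>p. of_bool (\<not> p)"] by simp
qed

lemma lehmer_mesic_in_ascents: "lehmer_mesic n (\<lambda>\<sigma>. of_bool (i \<in> ascents n \<sigma>))"
proof (cases "i \<in> {1..<n}")
  case True
  then show ?thesis
    using lehmer_mesic_descent_at[of i n "\<lambda>p. of_bool (\<not> p)"] by (simp add: in_ascents_iff)
next
  case False
  then show ?thesis
    by (simp only: in_ascents_iff simp_thms of_bool_eq lehmer_mesic_const)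
qed

lemma peaks_eq: "peaks n \<sigma> = {i \<in> {1..<n - 1}. \<not> \<sigma> (i + 1) < \<sigma> i \<and> \<sigma> (i + 2) < \<sigma> (i + 1)}"
  by (auto simp: peaks_def in_ascents_iff in_descents_iff)

lemma valleys_eq: "valleys n \<sigma> = {i \<in> {1..<n - 1}. \<sigma> (i + 1) < \<sigma> i \<and> \<not> \<sigma> (i + 2) < \<sigma> (i + 1)}"
  by (auto simp: valleys_def in_ascents_iff in_descents_iff)

lemma lehmer_mesic_peaks: "lehmer_mesic n (\<lambda>\<sigma>. int (card (peaks n \<sigma>)))"
  unfolding peaks_eq by (rule lehmer_mesic_card_shape)

lemma lehmer_mesic_valleys: "lehmer_mesic n (\<lambda>\<sigma>. int (card (valleys n \<sigma>)))"
  unfolding valleys_eq by (rule lehmer_mesic_card_shape)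

lemma lehmer_mesic_double_descents: "lehmer_mesic n (\<lambda>\<sigma>. int (card (double_descents n \<sigma>)))"
proof -
  have "double_descents n \<sigma> = {i \<in> {1..<n - 1}. \<sigma> (i + 1) < \<sigma> i \<and> \<sigma> (i + 2) < \<sigma> (i + 1)}" for \<sigma>
    by (auto simp: double_descents_def)
  then show ?thesis
    using lehmer_mesic_card_shape[of n "(\<and>)"] by simp
qed

lemma lehmer_mesic_double_ascents: "lehmer_mesic n (\<lambda>\<sigma>. int (card (double_ascents n \<sigma>)))"
proof -
  have "double_ascents n \<sigma> = {i \<in> {1..<n - 1}. \<not> \<sigma> (i + 1) < \<sigma> i \<and> \<not> \<sigma> (i + 2) < \<sigma> (i + 1)}"
    if "\<sigma> \<in> Sym n" for \<sigma>
    by (auto simp: double_ascents_def Sym_not_less_iff[OF that])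
  then show ?thesis
    using lehmer_mesic_card_shape[of n "\<lambda>p q. \<not> p \<and> \<not> q"] by (subst homomesic_cong) simp_all
qed

lemma finite_peaks: "finite (peaks n \<sigma>)"
  by (simp add: peaks_eq)

lemma finite_valleys: "finite (valleys n \<sigma>)"
  by (simp add: valleys_eq)

lemma lehmer_mesic_left_outer_peaks: "lehmer_mesic n (\<lambda>\<sigma>. int (card (left_outer_peaks n \<sigma>)))"
proof -
  have "int (card (left_outer_peaks n \<sigma>)) = int (card (peaks n \<sigma>)) + of_bool (1 \<in> descents n \<sigma>)"
    for \<sigma>
  proof -
    have "left_outer_peaks n \<sigma> = peaks n \<sigma> \<union> (if 1 \<in> descents n \<sigma> then {1} else {})"
      by (auto simp: left_outer_peaks_def)
    moreover have "1 \<in> descents n \<sigma> \<Longrightarrow> 1 \<notin> peaks n \<sigma>"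
      by (simp add: peaks_eq in_descents_iff)
    ultimately show ?thesis
      using finite_peaks by simp
  qed
  then show ?thesis
    by (simp only: homomesic_add lehmer_mesic_peaks lehmer_mesic_in_descents)
qed

lemma lehmer_mesic_right_outer_peaks: "lehmer_mesic n (\<lambda>\<sigma>. int (card (right_outer_peaks n \<sigma>)))"
proof -
  have "int (card (right_outer_peaks n \<sigma>)) =
      int (card (peaks n \<sigma>)) + of_bool (n - 1 \<in> ascents n \<sigma>)" for \<sigma>
  proof -
    have "right_outer_peaks n \<sigma> = peaks n \<sigma> \<union> (if n - 1 \<in> ascents n \<sigma> then {n - 1} else {})"
      by (auto simp: right_outer_peaks_def)
    moreover have "n - 1 \<notin> peaks n \<sigma>"
      by (simp add: peaks_eq)
    ultimately show ?thesis
      using finite_peaks by simp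
  qed
  then show ?thesis
    by (simp only: homomesic_add lehmer_mesic_peaks lehmer_mesic_in_ascents)
qed

lemma lehmer_mesic_num_outer_peaks: "lehmer_mesic n (\<lambda>\<sigma>. int (num_outer_peaks n \<sigma>))"
  unfolding num_outer_peaks_def of_nat_add of_nat_of_bool
  by (intro homomesic_add lehmer_mesic_peaks lehmer_mesic_in_ascents lehmer_mesic_in_descents)

lemma lehmer_mesic_num_valleys_with_boundary:
  "lehmer_mesic n (\<lambda>\<sigma>. int (num_valleys_with_boundary n \<sigma>))"
  unfolding num_valleys_with_boundary_def of_nat_add of_nat_of_bool
  by (intro homomesic_add lehmer_mesic_valleys lehmer_mesic_in_ascents lehmer_mesic_in_descents)

lemma lehmer_mesic_switches: "lehmer_mesic n (\<lambda>\<sigma>. int (card (peaks n \<sigma>) + card (valleys n \<sigma>)))"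
  unfolding of_nat_add by (intro homomesic_add lehmer_mesic_peaks lehmer_mesic_valleys)

section \<open>Descents of distance two\<close>

definition code_descent_dist2 :: "nat \<Rightarrow> (nat \<Rightarrow> nat) \<Rightarrow> bool" where
  "code_descent_dist2 i c \<longleftrightarrow> c (i + 2) + of_bool (c (i + 1) \<le> c (i + 2)) < c i"

lemma descent_dist2_iff_lehmer_code:
  assumes \<sigma>: "\<sigma> \<in> Sym n" and i: "i + 2 \<le> n"
  shows "\<sigma> (i + 2) < \<sigma> i \<longleftrightarrow> code_descent_dist2 i (lehmer_code n \<sigma>)"
proof -
  have "{i<..n} = insert (i + 1) (insert (i + 2) {i + 2<..n})"
    using i by auto
  then have "{j \<in> {i<..n}. \<sigma> j < \<sigma> (i + 2)} =
      {j \<in> {i + 2<..n}. \<sigma> j < \<sigma> (i + 2)} \<union> (if \<sigma> (i + 1) < \<sigma> (i + 2) then {i + 1} else {})"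
    by auto
  moreover have "card \<dots> = lehmer_code n \<sigma> (i + 2) + of_bool (\<sigma> (i + 1) < \<sigma> (i + 2))"
    by (simp add: lehmer_code_def)
  moreover have "\<sigma> (i + 1) < \<sigma> (i + 2) \<longleftrightarrow> lehmer_code n \<sigma> (i + 1) \<le> lehmer_code n \<sigma> (i + 2)"
    using descent_iff_lehmer_code[of "i + 1" n \<sigma>] Sym_not_less_iff[OF \<sigma>, of "i + 2" "i + 1"] i
    by (simp add: not_less[symmetric])
  ultimately show ?thesis
    using less_iff_card_less[of "{i<..n}" "i + 2" \<sigma> "\<sigma> i"] i
    by (simp add: lehmer_code_def code_descent_dist2_def)
qed

definition codeword_complement :: "nat \<Rightarrow> (nat \<Rightarrow> nat) \<Rightarrow> nat \<Rightarrow> nat" where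
  "codeword_complement n c = (\<lambda>j\<in>{1..n}. n - j - c j)"

lemma codeword_complement_in_codewords: "codeword_complement n c \<in> codewords n"
  by (auto simp: codeword_complement_def codewords_def)

lemma codeword_complement_involution:
  assumes "c \<in> codewords n"
  shows "codeword_complement n (codeword_complement n c) = c"
proof
  fix j
  show "codeword_complement n (codeword_complement n c) j = c j"
    using assms codewords_le[OF assms, of j]
    by (auto simp: codeword_complement_def codewords_def dest: PiE_arb)
qed

lemma even_codeword_complement_iff:
  assumes "c \<in> codewords n" "j \<in> {1..n}" "odd (n - j)"
  shows "even (codeword_complement n c j) \<longleftrightarrow> odd (c j)"
proof -
  have "c j \<le> n - j"
    using assms by (intro codewords_le)
  then have "even (n - j - c j) \<longleftrightarrow> even (n - j + c j)"
    by (simp only: even_diff_nat not_less[symmetric] simp_thms)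
  then show ?thesis
    using assms by (simp add: codeword_complement_def)
qed

lemma code_descent_dist2_complement_iff:
  assumes c: "c \<in> codewords n" and i: "1 \<le> i" "i + 2 \<le> n"
  shows "code_descent_dist2 i (codeword_complement n c) \<longleftrightarrow> \<not> code_descent_dist2 i c"
proof -
  let ?T = "codeword_complement n c"
  have i_in: "i \<in> {1..n}" "i + 1 \<in> {1..n}" "i + 2 \<in> {1..n}"
    using i by auto
  have T: "?T j = n - j - c j" if "j \<in> {1..n}" for j
    using that by (simp add: codeword_complement_def)
  note le = i_in[THEN codewords_le[OF c]]
  have "?T (i + 1) \<le> ?T (i + 2) \<longleftrightarrow> \<not> c (i + 1) \<le> c (i + 2)"
    unfolding i_in[THEN T] using le i by linarith
  moreover have "?T (i + 2) + k < ?T i \<longleftrightarrow> \<not> c (i + 2) + (1 - k) < c i" if "k \<le> 1" for k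
    unfolding i_in[THEN T] using le i that by linarith
  ultimately show ?thesis
    by (auto simp: code_descent_dist2_def of_bool_def)
qed

text \<open>
  Complementing the code, i.e. the values of the permutation, exchanges descents and ascents of
  distance two and preserves the sign.
\<close>

lemma sum_outer_sign_times_descent_dist2:
  assumes i: "1 \<le> i" "i + 2 \<le> n" and odd: "odd (n - i)"
  shows "(\<Sum>\<sigma>\<in>Sym n. outer_sign i (lehmer_code n \<sigma>) *
    of_bool (code_descent_dist2 i (lehmer_code n \<sigma>))) = 0"
proof -
  let ?T = "codeword_complement n"
  define h where "h = (\<lambda>c. outer_sign i c * (2 * of_bool (code_descent_dist2 i c) - 1))"
  have outer: "i \<in> {1..n}" "i + 2 \<in> {1..n}" "odd (n - (i + 2))"
    using i odd by (auto simp: diff_diff_add[symmetric])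
  have h_T: "h (?T c) + h c = 0" if c: "c \<in> codewords n" for c
  proof -
    have "outer_sign i (?T c) = outer_sign i c"
      using even_codeword_complement_iff[OF c outer(1) odd]
        even_codeword_complement_iff[OF c outer(2,3)]
      by (simp add: outer_sign_def minus_one_power_iff)
    then show ?thesis
      by (simp add: h_def code_descent_dist2_complement_iff[OF c i])
  qed
  have T_neq: "?T c \<noteq> c" if "c \<in> codewords n" for c
    using even_codeword_complement_iff[OF that outer(1) odd] by metis
  have "(\<Sum>\<sigma>\<in>Sym n. h (codeword n \<sigma>)) = 0"
    by (intro sum_codeword_eq_0_if_involution[of n ?T] codeword_complement_in_codewords
        codeword_complement_involution T_neq h_T)
  then have "2 * (\<Sum>\<sigma>\<in>Sym n. outer_sign i (lehmer_code n \<sigma>) *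
      of_bool (code_descent_dist2 i (lehmer_code n \<sigma>))) =
      (\<Sum>\<sigma>\<in>Sym n. outer_sign i (lehmer_code n \<sigma>))"
    using i by (simp add: h_def code_descent_dist2_def outer_sign_def algebra_simps
        sum_subtractf sum_distrib_left)
  also have "\<dots> = 0"
    using sum_outer_sign_times_shape[OF i odd, of "\<lambda>_ _. 1"] by simp
  finally show ?thesis
    by simp
qed

lemma lehmer_mesic_descent_dist2_at:
  assumes i: "1 \<le> i" "i + 2 \<le> n"
  shows "lehmer_mesic n (\<lambda>\<sigma>. of_bool (\<sigma> (i + 2) < \<sigma> i))"
proof (rule lehmer_mesic_if_three_code_entries[OF i])
  show "depends_on_code n {i, i + 1, i + 2} (\<lambda>\<sigma>. of_bool (\<sigma> (i + 2) < \<sigma> i))"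
    unfolding depends_on_code_def
    by (intro ballI impI)
      (simp only: descent_dist2_iff_lehmer_code[OF _ i(2)], simp add: code_descent_dist2_def)
  show "(\<Sum>\<sigma>\<in>Sym n. outer_sign i (lehmer_code n \<sigma>) * of_bool (\<sigma> (i + 2) < \<sigma> i)) = 0"
    if "odd (n - i)"
    using sum_outer_sign_times_descent_dist2[OF i that]
    by (simp only: descent_dist2_iff_lehmer_code[OF _ i(2)] cong: sum.cong)
qed

lemma lehmer_mesic_descents_dist2: "lehmer_mesic n (\<lambda>\<sigma>. int (card (descents_dist2 n \<sigma>)))"
proof -
  have "descents_dist2 n \<sigma> = {i \<in> {1..<n - 1}. \<sigma> (i + 2) < \<sigma> i}" for \<sigma>
    by (auto simp: descents_dist2_def)
  moreover have "lehmer_mesic n (\<lambda>\<sigma>. int (card {i \<in> {1..<n - 1}. \<sigma> (i + 2) < \<sigma> i}))"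
    by (intro lehmer_mesic_card_filter lehmer_mesic_descent_dist2_at) auto
  ultimately show ?thesis
    by simp
qed

lemma lehmer_mesic_ascents_dist2: "lehmer_mesic n (\<lambda>\<sigma>. int (card (ascents_dist2 n \<sigma>)))"
proof -
  let ?A = "{1..<n - 1}"
  have "int (card (ascents_dist2 n \<sigma>)) = int (card ?A) - int (card (descents_dist2 n \<sigma>))" for \<sigma>
  proof -
    have sub: "descents_dist2 n \<sigma> \<subseteq> ?A"
      by (auto simp: descents_dist2_def)
    have "ascents_dist2 n \<sigma> = ?A - descents_dist2 n \<sigma>"
      by (auto simp: ascents_dist2_def)
    then show ?thesis
      using card_mono[OF _ sub] finite_subset[OF sub] by (simp only: card_Diff_subset[OF _ sub]
          finite_atLeastLessThan of_nat_diff)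
  qed
  then show ?thesis
    by (simp only: homomesic_diff lehmer_mesic_const lehmer_mesic_descents_dist2)
qed

section \<open>Inversions\<close>

lemma card_eq_sum_card_Image:
  assumes "finite A" "finite B" "R \<subseteq> A \<times> B"
  shows "card R = (\<Sum>i\<in>A. card (R `` {i}))"
proof -
  have "R = Sigma A (\<lambda>i. R `` {i})"
    using assms(3) by auto
  moreover have "finite (R `` {i})" for i
    using assms by (auto intro: finite_subset[of _ B])
  ultimately show ?thesis
    using card_SigmaI[OF assms(1), of "\<lambda>i. R `` {i}"] by simp
qed

lemma lehmer_mesic_card_if_Image:
  assumes "finite A" "finite B" "\<And>\<sigma>. R \<sigma> \<subseteq> A \<times> B"
    and "\<And>i. i \<in> A \<Longrightarrow> lehmer_mesic n (\<lambda>\<sigma>. int (card (R \<sigma> `` {i})))"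
  shows "lehmer_mesic n (\<lambda>\<sigma>. int (card (R \<sigma>)))"
  unfolding card_eq_sum_card_Image[OF assms(1-3)] of_nat_sum
  by (intro lehmer_mesic_sum assms(4))

lemma lehmer_mesic_inversions_at:
  assumes "1 \<le> i"
  shows "lehmer_mesic n (\<lambda>\<sigma>. int (card {j \<in> {i<..n}. \<sigma> j < \<sigma> i}))"
proof (cases "i \<le> n")
  case True
  then show ?thesis
    using assms depends_on_code_comp[OF depends_on_code_lehmer_code[OF singletonI], of n i int]
    unfolding lehmer_code_def by (intro lehmer_mesic_if_code_entry) auto
next
  case False
  then have empty: "{i<..n} = {}"
    by simp
  show ?thesis
    unfolding empty by (simp add: lehmer_mesic_const)
qed

lemma lehmer_mesic_inversions: "lehmer_mesic n (\<lambda>\<sigma>. int (card (inversions n \<sigma>)))"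
proof (rule lehmer_mesic_card_if_Image[of "{1..n}" "{1..n}"])
  fix i assume i: "i \<in> {1..n}"
  then have "inversions n \<sigma> `` {i} = {j \<in> {i<..n}. \<sigma> j < \<sigma> i}" for \<sigma>
    by (auto simp: inversions_def)
  then show "lehmer_mesic n (\<lambda>\<sigma>. int (card (inversions n \<sigma> `` {i})))"
    using lehmer_mesic_inversions_at[of i n] i by simp
qed (auto simp: inversions_def)

lemma card_later_greater:
  assumes "\<sigma> \<in> Sym n"
  shows "card {j \<in> {i<..n}. \<sigma> i < \<sigma> j} = n - i - lehmer_code n \<sigma> i"
proof -
  have "{j \<in> {i<..n}. \<sigma> i < \<sigma> j} = {i<..n} - {j \<in> {i<..n}. \<sigma> j < \<sigma> i}"
    using Sym_not_less_iff[OF assms] by fastforce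
  then show ?thesis
    unfolding lehmer_code_def by (simp only: card_Diff_subset finite_Collect_conjI
        finite_greaterThanAtMost card_greaterThanAtMost Collect_mem_eq Collect_subset simp_thms)
qed

lemma depends_on_code_card_later_greater:
  "depends_on_code n {i} (\<lambda>\<sigma>. card {j \<in> {i<..n}. \<sigma> i < \<sigma> j})"
  by (simp only: depends_on_code_def card_later_greater cong: ball_cong) simp

lemma lehmer_mesic_noninversions: "lehmer_mesic n (\<lambda>\<sigma>. int (card (noninversions n \<sigma>)))"
proof (rule lehmer_mesic_card_if_Image[of "{1..n}" "{1..n}"])
  fix i assume i: "i \<in> {1..n}"
  then have "noninversions n \<sigma> `` {i} = {j \<in> {i<..n}. \<sigma> i < \<sigma> j}" for \<sigma>
    by (auto simp: noninversions_def)
  then show "lehmer_mesic n (\<lambda>\<sigma>. int (card (noninversions n \<sigma> `` {i})))"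
    using lehmer_mesic_if_code_entry[OF i
        depends_on_code_comp[OF depends_on_code_card_later_greater]]
    by simp
qed (auto simp: noninversions_def)

lemma lehmer_mesic_short_inversions:
  "lehmer_mesic n (\<lambda>\<sigma>. int (card {(i, j) \<in> inversions n \<sigma>. j - i \<le> 2}))"
proof -
  have "int (card {(i, j) \<in> inversions n \<sigma>. j - i \<le> 2}) =
      int (card (descents n \<sigma>)) + int (card (descents_dist2 n \<sigma>))" for \<sigma>
  proof -
    have "(i, j) \<in> inversions n \<sigma> \<and> j - i \<le> 2 \<longleftrightarrow>
        j = i + 1 \<and> i \<in> descents n \<sigma> \<or> j = i + 2 \<and> i \<in> descents_dist2 n \<sigma>" for i j
    proof -
      have "i < j \<and> j - i \<le> 2 \<longleftrightarrow> j = i + 1 \<or> j = i + 2"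
        by auto
      then show ?thesis
        by (auto simp: inversions_def descents_def descents_dist2_def)
    qed
    then have "{(i, j) \<in> inversions n \<sigma>. j - i \<le> 2} =
        (\<lambda>i. (i, i + 1)) ` descents n \<sigma> \<union> (\<lambda>i. (i, i + 2)) ` descents_dist2 n \<sigma>"
      by blast
    moreover have "finite (descents_dist2 n \<sigma>)"
      by (rule finite_subset[of _ "{..n}"]) (auto simp: descents_dist2_def)
    ultimately have "card {(i, j) \<in> inversions n \<sigma>. j - i \<le> 2} =
        card ((\<lambda>i. (i, i + 1)) ` descents n \<sigma>) + card ((\<lambda>i. (i, i + 2)) ` descents_dist2 n \<sigma>)"
      by (simp only:) (rule card_Un_disjoint, auto simp: finite_descents)
    then show ?thesis
      by (simp add: card_image inj_on_def)
  qed
  then show ?thesis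
    by (simp only: homomesic_add lehmer_mesic_descents lehmer_mesic_descents_dist2)
qed

section \<open>Vincular patterns\<close>

lemma bij_betw_rank:
  fixes f :: "'a \<Rightarrow> 'b::linorder"
  assumes fin: "finite K" and inj: "inj_on f K"
  shows "bij_betw (\<lambda>k. card {j \<in> K. f j < f k}) K {..<card K}"
proof -
  let ?r = "\<lambda>k. card {j \<in> K. f j < f k}"
  have "inj_on ?r K"
  proof (rule inj_onI)
    fix k l assume k: "k \<in> K" and l: "l \<in> K" and eq: "?r k = ?r l"
    have "\<not> f k < f l" "\<not> f l < f k"
      using less_iff_card_less[OF fin k, of f "f l"] less_iff_card_less[OF fin l, of f "f k"] eq
      by simp_all
    then have "f k = f l"
      by simp
    then show "k = l"
      using inj_onD[OF inj] k l by blast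
  qed
  moreover have "?r k < card K" if "k \<in> K" for k
    by (rule psubset_card_mono[OF fin]) (use that in auto)
  then have "?r ` K \<subseteq> {..<card K}"
    by auto
  ultimately show ?thesis
    by (simp add: bij_betw_def card_subset_eq card_image)
qed

text \<open>The bijection matches elements of equal rank.\<close>

lemma order_matching:
  fixes f :: "'a \<Rightarrow> 'b::linorder" and g :: "'c \<Rightarrow> 'd::linorder"
  assumes K: "finite K" "inj_on f K" and L: "finite L" "inj_on g L" and card: "card K = card L"
  obtains \<pi> where "bij_betw \<pi> K L"
    and "\<And>k x y. k \<in> K \<Longrightarrow> card {j \<in> K. f j < x} = card {j \<in> L. g j < y} \<Longrightarrow>
      f k < x \<longleftrightarrow> g (\<pi> k) < y"
proof -
  let ?r = "\<lambda>k. card {j \<in> K. f j < f k}" and ?s = "\<lambda>l. card {j \<in> L. g j < g l}"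
  have r: "bij_betw ?r K {..<card L}" and s: "bij_betw ?s L {..<card L}"
    using bij_betw_rank[OF K] bij_betw_rank[OF L] card by simp_all
  define \<pi> where "\<pi> = inv_into L ?s \<circ> ?r"
  have \<pi>: "bij_betw \<pi> K L"
    unfolding \<pi>_def using r bij_betw_inv_into[OF s] by (rule bij_betw_trans)
  have "f k < x \<longleftrightarrow> g (\<pi> k) < y"
    if k: "k \<in> K" and eq: "card {j \<in> K. f j < x} = card {j \<in> L. g j < y}" for k x y
  proof -
    have "?s (\<pi> k) = ?r k"
      using bij_betw_inv_into_right[OF s] bij_betw_apply[OF r k] by (simp add: \<pi>_def)
    then show ?thesis
      using less_iff_card_less[OF K(1) k, of f x]
        less_iff_card_less[OF L(1) bij_betw_apply[OF \<pi> k], of g y] eq by simp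
  qed
  then show thesis
    by (rule that[OF \<pi>])
qed

lemma same_relative_order_triple:
  "same_relative_order [x, y, z] [p, q, r] \<longleftrightarrow>
    (x < y \<longleftrightarrow> p < q) \<and> (x < z \<longleftrightarrow> p < r) \<and> (y < x \<longleftrightarrow> q < p) \<and>
    (y < z \<longleftrightarrow> q < r) \<and> (z < x \<longleftrightarrow> r < p) \<and> (z < y \<longleftrightarrow> r < q)"
  by (simp add: same_relative_order_def All_less_Suc numeral_3_eq_3) blast

lemma same_relative_order_cong_left:
  "same_relative_order xs ys \<Longrightarrow> same_relative_order xs p \<longleftrightarrow> same_relative_order ys p"
  by (auto simp: same_relative_order_def)

lemma lehmer_code_eq_add_of_bool_descent:
  assumes "i < n"
  shows "lehmer_code n \<sigma> i = card {j \<in> {i + 1<..n}. \<sigma> j < \<sigma> i} + of_bool (\<sigma> (i + 1) < \<sigma> i)"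
proof -
  have "{j \<in> {i<..n}. \<sigma> j < \<sigma> i} =
      {j \<in> {i + 1<..n}. \<sigma> j < \<sigma> i} \<union> (if \<sigma> (i + 1) < \<sigma> i then {i + 1} else {})"
    using greaterThanAtMost_eq_insert[OF assms] by auto
  then show ?thesis
    by (simp add: lehmer_code_def)
qed

text \<open>
  The code entries at \<open>i\<close> and \<open>i + 1\<close> determine how many of the values after position \<open>i + 1\<close>
  lie below \<open>\<sigma> i\<close> and below \<open>\<sigma> (i + 1)\<close>, hence how they are arranged relative to both.
\<close>

lemma depends_on_code_card_later:
  assumes i: "i < n"
    and R: "\<And>x y z x' y' z'. same_relative_order [x, y, z] [x', y', z'] \<Longrightarrow> R x y z \<longleftrightarrow> R x' y' z'"
  shows "depends_on_code n {i, i + 1} (\<lambda>\<sigma>. card {k \<in> {i + 1<..n}. R (\<sigma> i) (\<sigma> (i + 1)) (\<sigma> k)})"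
  unfolding depends_on_code_def
proof (intro ballI impI)
  fix \<sigma> \<tau>
  assume \<sigma>: "\<sigma> \<in> Sym n" and \<tau>: "\<tau> \<in> Sym n"
    and code: "\<forall>j\<in>{i, i + 1}. lehmer_code n \<sigma> j = lehmer_code n \<tau> j"
  let ?K = "{i + 1<..n}"
  have desc: "\<sigma> (i + 1) < \<sigma> i \<longleftrightarrow> \<tau> (i + 1) < \<tau> i"
    using depends_on_code_descent[OF i] \<sigma> \<tau> code unfolding depends_on_code_def by blast
  have below: "card {j \<in> ?K. \<sigma> j < \<sigma> i} = card {j \<in> ?K. \<tau> j < \<tau> i}"
    "card {j \<in> ?K. \<sigma> j < \<sigma> (i + 1)} = card {j \<in> ?K. \<tau> j < \<tau> (i + 1)}"
    using lehmer_code_eq_add_of_bool_descent[OF i, of \<sigma>]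
      lehmer_code_eq_add_of_bool_descent[OF i, of \<tau>] desc code
    by (simp_all add: lehmer_code_def)
  obtain \<pi> where \<pi>: "bij_betw \<pi> ?K ?K" and
    less: "\<And>k x y. k \<in> ?K \<Longrightarrow> card {j \<in> ?K. \<sigma> j < x} = card {j \<in> ?K. \<tau> j < y} \<Longrightarrow>
      \<sigma> k < x \<longleftrightarrow> \<tau> (\<pi> k) < y"
    by (rule order_matching[where K = ?K and L = ?K, OF finite_greaterThanAtMost Sym_inj_on[OF \<sigma>]
          finite_greaterThanAtMost Sym_inj_on[OF \<tau>] refl]) (rule that)
  have "same_relative_order [\<sigma> i, \<sigma> (i + 1), \<sigma> k] [\<tau> i, \<tau> (i + 1), \<tau> (\<pi> k)]" if k: "k \<in> ?K" for k
  proof -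
    have ne: "i \<noteq> i + 1" "i \<noteq> k" "i + 1 \<noteq> k" "i \<noteq> \<pi> k" "i + 1 \<noteq> \<pi> k"
      using bij_betw_apply[OF \<pi> k] k by auto
    show ?thesis
      unfolding same_relative_order_triple
      using less[OF k below(1)] less[OF k below(2)] desc ne[THEN Sym_not_less_iff[OF \<sigma>]]
        ne[THEN Sym_not_less_iff[OF \<tau>]] by blast
  qed
  then have "bij_betw \<pi> {k \<in> ?K. R (\<sigma> i) (\<sigma> (i + 1)) (\<sigma> k)} {k \<in> ?K. R (\<tau> i) (\<tau> (i + 1)) (\<tau> k)}"
    by (intro bij_betw_Collect[OF \<pi>] R[symmetric])
  then show "card {k \<in> ?K. R (\<sigma> i) (\<sigma> (i + 1)) (\<sigma> k)} = card {k \<in> ?K. R (\<tau> i) (\<tau> (i + 1)) (\<tau> k)}"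
    by (rule bij_betw_same_card)
qed

lemma vinc_occurrences_subset: "vinc_occurrences p n \<sigma> \<subseteq> {1..<n} \<times> {..n} \<times> {..n}"
  by (auto simp: vinc_occurrences_def occurrences_def)

lemma lehmer_mesic_vinc_occurrences_at:
  assumes i: "1 \<le> i" "i < n"
  shows "lehmer_mesic n (\<lambda>\<sigma>. int (card (vinc_occurrences p n \<sigma> `` {i})))"
proof -
  let ?K = "\<lambda>\<sigma>. {k \<in> {i + 1<..n}. same_relative_order [\<sigma> i, \<sigma> (i + 1), \<sigma> k] p}"
  have "vinc_occurrences p n \<sigma> `` {i} = Pair (i + 1) ` ?K \<sigma>" for \<sigma>
    using i by (auto simp: vinc_occurrences_def occurrences_def)
  then have "card (vinc_occurrences p n \<sigma> `` {i}) = card (?K \<sigma>)" for \<sigma>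
    by (simp add: card_image inj_on_def)
  moreover have "depends_on_code n {i, i + 1} (\<lambda>\<sigma>. card (?K \<sigma>))"
    by (rule depends_on_code_card_later[OF i(2)]) (rule same_relative_order_cong_left)
  ultimately show ?thesis
    using lehmer_mesic_if_adjacent_code_entries[OF i depends_on_code_comp] by simp
qed

lemma lehmer_mesic_vinc_occurrences: "lehmer_mesic n (\<lambda>\<sigma>. int (card (vinc_occurrences p n \<sigma>)))"
  by (rule lehmer_mesic_card_if_Image[OF _ _ vinc_occurrences_subset])
    (auto intro: lehmer_mesic_vinc_occurrences_at)

lemma lehmer_mesic_initial_123: "lehmer_mesic n (\<lambda>\<sigma>. int (card (occurrences_initial_123 n \<sigma>)))"
proof -
  have initial: "occurrences_initial_123 n \<sigma> = Pair 1 ` (vinc_occurrences [1, 2, 3] n \<sigma> `` {1})" for \<sigma>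
    by (auto simp: occurrences_initial_123_def vinc_occurrences_def)
  have card: "card (occurrences_initial_123 n \<sigma>) = card (vinc_occurrences [1, 2, 3] n \<sigma> `` {1})" for \<sigma>
    unfolding initial by (simp add: card_image inj_on_def)
  show ?thesis
  proof (cases "1 < n")
    case True
    then show ?thesis
      unfolding card by (intro lehmer_mesic_vinc_occurrences_at) auto
  next
    case False
    then have "vinc_occurrences [1, 2, 3] n \<sigma> `` {1} = {}" for \<sigma>
      using vinc_occurrences_subset[of "[1, 2, 3]" n \<sigma>] by auto
    then show ?thesis
      unfolding card by (simp add: lehmer_mesic_const)
  qed
qed

lemma lehmer_mesic_bs_stat: "lehmer_mesic n (\<lambda>\<sigma>. int (bs_stat n \<sigma>))"
  unfolding bs_stat_def of_nat_add
  by (intro homomesic_add lehmer_mesic_vinc_occurrences lehmer_mesic_descents)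

lemma lehmer_mesic_bs_stat': "lehmer_mesic n (\<lambda>\<sigma>. int (bs_stat' n \<sigma>))"
  unfolding bs_stat'_def of_nat_add
  by (intro homomesic_add lehmer_mesic_vinc_occurrences lehmer_mesic_descents)

definition increasing_pairs :: "'a::linorder set \<Rightarrow> ('a \<times> 'a) set" where
  "increasing_pairs A = {(j, k). j \<in> A \<and> k \<in> A \<and> j < k}"

lemma finite_increasing_pairs: "finite A \<Longrightarrow> finite (increasing_pairs A)"
  by (rule finite_subset[of _ "A \<times> A"]) (auto simp: increasing_pairs_def)

lemma card_increasing_pairs:
  assumes "finite A"
  shows "card (increasing_pairs A) = card A choose 2"
  using assms
proof (induction A rule: finite_linorder_max_induct)
  case (insert b A)
  have "increasing_pairs (insert b A) = increasing_pairs A \<union> A \<times> {b}"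
    using insert.hyps by (auto simp: increasing_pairs_def)
  moreover have "card \<dots> = card (increasing_pairs A) + card (A \<times> {b})"
    using insert.hyps
    by (intro card_Un_disjoint)
      (auto simp: finite_increasing_pairs, auto simp: increasing_pairs_def)
  moreover have "b \<notin> A"
    using insert.hyps by auto
  ultimately show ?case
    using insert by (simp add: numeral_2_eq_2)
qed (simp add: increasing_pairs_def)

lemma lehmer_mesic_occurrences_14_23: "lehmer_mesic n (\<lambda>\<sigma>. int (card (occurrences_14_23 n \<sigma>)))"
proof (rule lehmer_mesic_card_if_Image[of "{1..<n}" "{..n} \<times> {..n}"])
  fix i assume "i \<in> {1..<n}"
  then have i: "1 \<le> i" "i < n"
    by auto
  let ?K = "\<lambda>\<sigma>. {k \<in> {i + 1<..n}. \<sigma> i < \<sigma> k \<and> \<sigma> k < \<sigma> (i + 1)}"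
  have "occurrences_14_23 n \<sigma> `` {i} = increasing_pairs (?K \<sigma>)" for \<sigma>
    using i by (auto simp: occurrences_14_23_def increasing_pairs_def)
  then have "card (occurrences_14_23 n \<sigma> `` {i}) = card (?K \<sigma>) choose 2" for \<sigma>
    by (simp add: card_increasing_pairs)
  moreover have "depends_on_code n {i, i + 1} (\<lambda>\<sigma>. card (?K \<sigma>))"
    by (rule depends_on_code_card_later[OF i(2), where R = "\<lambda>x y z. x < z \<and> z < y"])
      (simp add: same_relative_order_triple)
  then have "lehmer_mesic n (\<lambda>\<sigma>. int (card (?K \<sigma>) choose 2))"
    by (rule lehmer_mesic_if_adjacent_code_entries[OF i depends_on_code_comp])
  ultimately show "lehmer_mesic n (\<lambda>\<sigma>. int (card (occurrences_14_23 n \<sigma> `` {i})))"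
    by simp
qed (auto simp: occurrences_14_23_def)

section \<open>Classical patterns of length three\<close>

lemma card_symmetric_pairs:
  fixes K :: "'a::linorder set"
  assumes K: "finite K" and sym: "\<And>j k. S j k \<longleftrightarrow> S k j"
  shows "card {(j, k) \<in> K \<times> K. j \<noteq> k \<and> S j k} = 2 * card {(j, k) \<in> increasing_pairs K. S j k}"
proof -
  let ?P = "{(j, k) \<in> increasing_pairs K. S j k}"
  have "{(j, k) \<in> K \<times> K. j \<noteq> k \<and> S j k} = ?P \<union> ?P\<inverse>"
    using sym by (auto simp: increasing_pairs_def)
  moreover have "finite ?P"
    using finite_increasing_pairs[OF K] by (rule finite_subset[rotated]) auto
  moreover have "?P \<inter> ?P\<inverse> = {}"
    by (auto simp: increasing_pairs_def)
  ultimately show ?thesis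
    by (simp only: card_Un_disjoint finite_converse card_inverse mult_2)
qed

lemma depends_on_code_card_later_pairs:
  assumes sym: "\<And>p q. Q p q \<longleftrightarrow> Q q p"
  shows "depends_on_code n {i}
    (\<lambda>\<sigma>. card {(j, k) \<in> increasing_pairs {i<..n}. Q (\<sigma> j < \<sigma> i) (\<sigma> k < \<sigma> i)})"
  unfolding depends_on_code_def
proof (intro ballI impI)
  fix \<sigma> \<tau>
  assume \<sigma>: "\<sigma> \<in> Sym n" and \<tau>: "\<tau> \<in> Sym n"
    and code: "\<forall>j\<in>{i}. lehmer_code n \<sigma> j = lehmer_code n \<tau> j"
  let ?K = "{i<..n}"
  let ?S = "\<lambda>\<sigma> (j, k). j \<noteq> k \<and> Q (\<sigma> j < \<sigma> i) (\<sigma> k < \<sigma> i)"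
  have double: "card {x \<in> ?K \<times> ?K. ?S \<rho> x} =
      2 * card {(j, k) \<in> increasing_pairs ?K. Q (\<rho> j < \<rho> i) (\<rho> k < \<rho> i)}" for \<rho> :: "nat \<Rightarrow> nat"
    using card_symmetric_pairs[of ?K "\<lambda>j k. Q (\<rho> j < \<rho> i) (\<rho> k < \<rho> i)", OF _ sym]
    by (simp only: finite_greaterThanAtMost case_prod_unfold prod.collapse)
  obtain \<pi> where \<pi>: "bij_betw \<pi> ?K ?K" and
    less: "\<And>k x y. k \<in> ?K \<Longrightarrow> card {j \<in> ?K. \<sigma> j < x} = card {j \<in> ?K. \<tau> j < y} \<Longrightarrow>
      \<sigma> k < x \<longleftrightarrow> \<tau> (\<pi> k) < y"
    by (rule order_matching[where K = ?K and L = ?K, OF finite_greaterThanAtMost Sym_inj_on[OF \<sigma>]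
          finite_greaterThanAtMost Sym_inj_on[OF \<tau>] refl]) (rule that)
  have "\<sigma> k < \<sigma> i \<longleftrightarrow> \<tau> (\<pi> k) < \<tau> i" if "k \<in> ?K" for k
    using less[OF that] code by (simp add: lehmer_code_def)
  then have "?S \<tau> (map_prod \<pi> \<pi> x) \<longleftrightarrow> ?S \<sigma> x" if "x \<in> ?K \<times> ?K" for x
    using that bij_betw_imp_inj_on[OF \<pi>] by (auto simp: inj_on_eq_iff)
  then have "bij_betw (map_prod \<pi> \<pi>) {x \<in> ?K \<times> ?K. ?S \<sigma> x} {x \<in> ?K \<times> ?K. ?S \<tau> x}"
    by (intro bij_betw_Collect bij_betw_map_prod \<pi>)
  then have "card {x \<in> ?K \<times> ?K. ?S \<sigma> x} = card {x \<in> ?K \<times> ?K. ?S \<tau> x}"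
    by (rule bij_betw_same_card)
  then show "card {(j, k) \<in> increasing_pairs ?K. Q (\<sigma> j < \<sigma> i) (\<sigma> k < \<sigma> i)} =
      card {(j, k) \<in> increasing_pairs ?K. Q (\<tau> j < \<tau> i) (\<tau> k < \<tau> i)}"
    unfolding double by simp
qed

lemma lehmer_mesic_occurrences_pair:
  assumes neq: "\<not> same_relative_order p q" and sym: "\<And>a b. Q a b \<longleftrightarrow> Q b a"
    and Q: "\<And>x y z. distinct [x, y, z] \<Longrightarrow>
      same_relative_order [x, y, z] p \<or> same_relative_order [x, y, z] q \<longleftrightarrow> Q (y < x) (z < x)"
  shows "lehmer_mesic n (\<lambda>\<sigma>. int (card (occurrences p n \<sigma>) + card (occurrences q n \<sigma>)))"
proof -
  let ?R = "\<lambda>\<sigma>. occurrences p n \<sigma> \<union> occurrences q n \<sigma>"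
  have subset: "occurrences r n \<sigma> \<subseteq> {1..n} \<times> {..n} \<times> {..n}" for r \<sigma>
    by (auto simp: occurrences_def)
  have "card (occurrences p n \<sigma>) + card (occurrences q n \<sigma>) = card (?R \<sigma>)" for \<sigma>
    using finite_subset[OF subset] neq same_relative_order_cong_left[of _ p q]
    by (intro card_Un_disjoint[symmetric]) (auto simp: occurrences_def)
  moreover have "lehmer_mesic n (\<lambda>\<sigma>. int (card (?R \<sigma>)))"
  proof (rule lehmer_mesic_card_if_Image[of "{1..n}" "{..n} \<times> {..n}"])
    fix i assume i: "i \<in> {1..n}"
    let ?P = "\<lambda>\<sigma>. {(j, k) \<in> increasing_pairs {i<..n}. Q (\<sigma> j < \<sigma> i) (\<sigma> k < \<sigma> i)}"
    have "?R \<sigma> `` {i} = ?P \<sigma>" if \<sigma>: "\<sigma> \<in> Sym n" for \<sigma>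
    proof -
      have "same_relative_order [\<sigma> i, \<sigma> j, \<sigma> k] p \<or> same_relative_order [\<sigma> i, \<sigma> j, \<sigma> k] q \<longleftrightarrow>
          Q (\<sigma> j < \<sigma> i) (\<sigma> k < \<sigma> i)" if "i < j" "j < k" for j k
        using that by (intro Q) (simp add: Sym_eq_iff[OF \<sigma>])
      then show ?thesis
        using i by (auto simp: occurrences_def increasing_pairs_def)
    qed
    moreover have "lehmer_mesic n (\<lambda>\<sigma>. int (card (?P \<sigma>)))"
      using depends_on_code_comp[OF depends_on_code_card_later_pairs[OF sym]]
      by (rule lehmer_mesic_if_code_entry[OF i])
    ultimately show "lehmer_mesic n (\<lambda>\<sigma>. int (card (?R \<sigma> `` {i})))"
      by (subst homomesic_cong) simp_all
  qed (use subset in auto)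
  ultimately show ?thesis
    by simp
qed

lemma lehmer_mesic_123_132:
  "lehmer_mesic n
    (\<lambda>\<sigma>. int (card (occurrences [1, 2, 3] n \<sigma>) + card (occurrences [1, 3, 2] n \<sigma>)))"
  by (rule lehmer_mesic_occurrences_pair[where Q = "\<lambda>a b. \<not> a \<and> \<not> b"])
    (auto simp: same_relative_order_triple)

lemma lehmer_mesic_213_231:
  "lehmer_mesic n
    (\<lambda>\<sigma>. int (card (occurrences [2, 1, 3] n \<sigma>) + card (occurrences [2, 3, 1] n \<sigma>)))"
  by (rule lehmer_mesic_occurrences_pair[where Q = "\<lambda>a b. a \<noteq> b"])
    (auto simp: same_relative_order_triple)

lemma lehmer_mesic_312_321:
  "lehmer_mesic n
    (\<lambda>\<sigma>. int (card (occurrences [3, 1, 2] n \<sigma>) + card (occurrences [3, 2, 1] n \<sigma>)))"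
  by (rule lehmer_mesic_occurrences_pair[where Q = "\<lambda>a b. a \<and> b"])
    (auto simp: same_relative_order_triple)

section \<open>Runs\<close>

lemma maximal_segmentsD:
  assumes "(a, b) \<in> maximal_segments n P"
  shows "1 \<le> a" "a \<le> b" "b \<le> n" "P {a..b}"
    and "1 \<le> a' \<Longrightarrow> a' \<le> a \<Longrightarrow> b \<le> b' \<Longrightarrow> b' \<le> n \<Longrightarrow> P {a'..b'} \<Longrightarrow> a' = a \<and> b' = b"
  using assms unfolding maximal_segments_def by blast+

lemma inj_on_snd_maximal_segments: "inj_on snd (maximal_segments n P)"
proof (rule inj_onI)
  fix x y assume x: "x \<in> maximal_segments n P" and y: "y \<in> maximal_segments n P" and "snd x = snd y"
  then obtain a a' b where "x = (a, b)" "y = (a', b)"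
    by (metis prod.collapse)
  with x y show "x = y"
    using maximal_segmentsD[of a b n P] maximal_segmentsD[of a' b n P] by (metis le_refl nle_le)
qed

text \<open>
  A maximal segment ends at \<open>n\<close> or one step before a window \<open>{i..i + d}\<close> with \<open>i \<in> B\<close> does.
  Runs are the case \<open>d = 1\<close>, maximal monotone segments the case \<open>d = 2\<close>.
\<close>

context
  fixes n d :: nat and B :: "nat set" and P :: "nat set \<Rightarrow> bool"
  assumes n: "1 \<le> n" and d: "1 \<le> d" and B: "\<And>i. i \<in> B \<Longrightarrow> 1 \<le> i \<and> i + d \<le> n"
    and P: "\<And>a b. 1 \<le> a \<Longrightarrow> a \<le> b \<Longrightarrow> b \<le> n \<Longrightarrow> P {a..b} \<longleftrightarrow> (\<forall>i\<in>B. a \<le> i \<longrightarrow> b < i + d)"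
begin

lemma maximal_segment_end:
  assumes "(a, b) \<in> maximal_segments n P" "b \<noteq> n"
  shows "b \<in> (\<lambda>i. i + d - 1) ` B"
proof -
  note ab = maximal_segmentsD(1-4)[OF assms(1)]
  have "\<not> P {a..b + 1}"
    using maximal_segmentsD(5)[OF assms(1), of a "b + 1"] ab assms(2) by auto
  then obtain i where i: "i \<in> B" "a \<le> i" "i + d \<le> b + 1"
    using ab assms(2) P[of a "b + 1"] by auto
  then have "b = i + d - 1"
    using ab P[of a b] by fastforce
  then show ?thesis
    using i(1) by blast
qed

lemma ex_maximal_segment_ending_at:
  assumes b: "1 \<le> b" "b \<le> n" and stop: "b = n \<or> b \<in> (\<lambda>i. i + d - 1) ` B"
  shows "\<exists>a. (a, b) \<in> maximal_segments n P"
proof -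
  define a where "a = (LEAST a. 1 \<le> a \<and> a \<le> b \<and> P {a..b})"
  have "P {b..b}"
    using b d P[of b b] by auto
  then have a: "1 \<le> a" "a \<le> b" "P {a..b}"
    using LeastI[of "\<lambda>a. 1 \<le> a \<and> a \<le> b \<and> P {a..b}" b] b by (auto simp: a_def)
  have a_le: "a \<le> a'" if "1 \<le> a'" "a' \<le> b" "P {a'..b}" for a'
    unfolding a_def using that by (intro Least_le) simp
  have "a' = a \<and> b' = b" if ext: "1 \<le> a'" "a' \<le> a" "b \<le> b'" "b' \<le> n" "P {a'..b'}" for a' b'
  proof -
    have "P {a'..b}"
      using ext a b P[of a' b'] P[of a' b] by fastforce
    then have a': "a' = a"
      using a_le[of a'] ext a by simp
    have "b' \<le> b"
    proof (rule ccontr)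
      assume "\<not> b' \<le> b"
      then obtain i where i: "i \<in> B" "b = i + d - 1"
        using stop ext by auto
      then have "P {i..b}"
        using P[of i b] B[of i] d b by auto
      then have "a \<le> i"
        using a_le[of i] B[of i] i d by auto
      then have "b' < i + d"
        using P[of a b'] ext a a' i by auto
      then show False
        using \<open>\<not> b' \<le> b\<close> i d by simp
    qed
    then show ?thesis
      using a' ext by simp
  qed
  then have "(a, b) \<in> maximal_segments n P"
    using a b unfolding maximal_segments_def by blast
  then show ?thesis ..
qed

lemma card_maximal_segments: "card (maximal_segments n P) = card B + 1"
proof -
  let ?ends = "(\<lambda>i. i + d - 1) ` B"
  have ends: "1 \<le> b \<and> b < n" if "b \<in> ?ends" for b
    using that B d by fastforce
  have "snd ` maximal_segments n P = insert n ?ends"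
  proof (intro equalityI subsetI)
    fix b assume "b \<in> snd ` maximal_segments n P"
    then show "b \<in> insert n ?ends"
      using maximal_segment_end by fastforce
  next
    fix b assume "b \<in> insert n ?ends"
    then show "b \<in> snd ` maximal_segments n P"
      using ex_maximal_segment_ending_at[of b] n ends by force
  qed
  moreover have "n \<notin> ?ends"
    using ends by blast
  moreover have "finite B"
    by (rule finite_subset[of B "{..n}"]) (auto dest: B)
  moreover have "inj_on (\<lambda>i. i + d - 1) B"
    using d by (auto simp: inj_on_def)
  ultimately have "card (snd ` maximal_segments n P) = card B + 1"
    by (simp add: card_image)
  then show ?thesis
    by (simp add: card_image[OF inj_on_snd_maximal_segments])
qed

end

lemma monotone_on_atLeastAtMost_iff:
  fixes f :: "nat \<Rightarrow> 'a"
  assumes "transp R"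
  shows "monotone_on {a..b} (<) R f \<longleftrightarrow> (\<forall>i\<in>{a..<b}. R (f i) (f (i + 1)))"
proof
  assume step: "\<forall>i\<in>{a..<b}. R (f i) (f (i + 1))"
  show "monotone_on {a..b} (<) R f"
  proof (rule monotone_onI)
    fix i j assume "i \<in> {a..b}" "j \<in> {a..b}" "i < j"
    from \<open>i < j\<close> have "a \<le> i \<longrightarrow> j \<le> b \<longrightarrow> R (f i) (f j)"
      by (induction rule: less_Suc_induct) (use step assms in \<open>auto elim: transpE\<close>)
    then show "R (f i) (f j)"
      using \<open>i \<in> {a..b}\<close> \<open>j \<in> {a..b}\<close> by simp
  qed
qed (auto intro: monotone_onD)

lemma card_runs:
  assumes \<sigma>: "\<sigma> \<in> Sym n" and n: "1 \<le> n"
  shows "card (runs n \<sigma>) = card (descents n \<sigma>) + 1"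
  unfolding runs_def
proof (rule card_maximal_segments[OF n order_refl])
  fix a b :: nat assume "1 \<le> a" "b \<le> n"
  then have "(\<forall>i\<in>{a..<b}. \<not> \<sigma> (i + 1) < \<sigma> i) \<longleftrightarrow> (\<forall>i\<in>descents n \<sigma>. a \<le> i \<longrightarrow> b < i + 1)"
    by (fastforce simp: descents_def)
  then show "strict_mono_on {a..b} \<sigma> \<longleftrightarrow> (\<forall>i\<in>descents n \<sigma>. a \<le> i \<longrightarrow> b < i + 1)"
    by (simp add: monotone_on_atLeastAtMost_iff Sym_not_less_iff[OF \<sigma>])
qed (auto simp: descents_def)

lemma all_or_none_iff_adjacent_eq:
  "(\<forall>i\<in>{a..<b}. D i) \<or> (\<forall>i\<in>{a..<b}. \<not> D i) \<longleftrightarrow> (\<forall>i. a \<le> i \<and> i + 1 < b \<longrightarrow> (D i \<longleftrightarrow> D (i + 1)))"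
  for a b :: nat
proof
  assume adjacent: "\<forall>i. a \<le> i \<and> i + 1 < b \<longrightarrow> (D i \<longleftrightarrow> D (i + 1))"
  have "D i \<longleftrightarrow> D a" if "a \<le> i" "i < b" for i
    using that by (induction rule: dec_induct) (use adjacent in auto)
  then show "(\<forall>i\<in>{a..<b}. D i) \<or> (\<forall>i\<in>{a..<b}. \<not> D i)"
    by (metis atLeastLessThan_iff)
qed auto

lemma card_maximal_monotone_segments:
  assumes \<sigma>: "\<sigma> \<in> Sym n" and n: "1 \<le> n"
  shows "card (maximal_segments n (\<lambda>A. strict_mono_on A \<sigma> \<or> strict_antimono_on A \<sigma>)) =
    card (peaks n \<sigma>) + card (valleys n \<sigma>) + 1"
proof -
  let ?D = "\<lambda>i. \<sigma> (i + 1) < \<sigma> i"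
  let ?B = "{i \<in> {1..<n - 1}. ?D i \<noteq> ?D (i + 1)}"
  have ascent: "\<sigma> i < \<sigma> (i + 1) \<longleftrightarrow> \<not> ?D i" for i
    using Sym_not_less_iff[OF \<sigma>, of "i + 1" i] by simp
  have "card (maximal_segments n (\<lambda>A. strict_mono_on A \<sigma> \<or> strict_antimono_on A \<sigma>)) = card ?B + 1"
  proof (rule card_maximal_segments[OF n one_le_numeral])
    fix a b :: nat assume ab: "1 \<le> a" "b \<le> n"
    have "strict_mono_on {a..b} \<sigma> \<or> strict_antimono_on {a..b} \<sigma> \<longleftrightarrow>
        (\<forall>i\<in>{a..<b}. ?D i) \<or> (\<forall>i\<in>{a..<b}. \<not> ?D i)"
      unfolding monotone_on_atLeastAtMost_iff[OF transp_on_less]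
        monotone_on_atLeastAtMost_iff[OF transp_on_greater] ascent by blast
    also have "\<dots> \<longleftrightarrow> (\<forall>i\<in>?B. a \<le> i \<longrightarrow> b < i + 2)"
    proof -
      have "a \<le> i \<and> i + 1 < b \<longleftrightarrow> i \<in> {1..<n - 1} \<and> a \<le> i \<and> \<not> b < i + 2" for i
        using ab by auto
      then show ?thesis
        unfolding all_or_none_iff_adjacent_eq by blast
    qed
    finally show "strict_mono_on {a..b} \<sigma> \<or> strict_antimono_on {a..b} \<sigma> \<longleftrightarrow>
        (\<forall>i\<in>?B. a \<le> i \<longrightarrow> b < i + 2)" .
  qed auto
  moreover have "?B = peaks n \<sigma> \<union> valleys n \<sigma>" "peaks n \<sigma> \<inter> valleys n \<sigma> = {}"
    by (auto simp: peaks_eq valleys_eq)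
  ultimately show ?thesis
    by (simp add: card_Un_disjoint finite_peaks finite_valleys)
qed

lemma lehmer_mesic_runs:
  assumes "1 \<le> n"
  shows "lehmer_mesic n (\<lambda>\<sigma>. int (card (runs n \<sigma>)))"
proof -
  have "lehmer_mesic n (\<lambda>\<sigma>. int (card (descents n \<sigma>)) + 1)"
    by (intro homomesic_add lehmer_mesic_descents lehmer_mesic_const)
  then show ?thesis
    using card_runs[OF _ assms] by (subst homomesic_cong) simp_all
qed

lemma lehmer_mesic_num_updown_runs:
  assumes "1 \<le> n"
  shows "lehmer_mesic n (\<lambda>\<sigma>. int (num_updown_runs n \<sigma>))"
proof -
  let ?g = "\<lambda>\<sigma>. int (card (peaks n \<sigma>)) + int (card (valleys n \<sigma>)) + 1 +
    of_bool (1 \<in> descents n \<sigma>)"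
  have "lehmer_mesic n ?g"
    by (intro homomesic_add lehmer_mesic_peaks lehmer_mesic_valleys lehmer_mesic_in_descents
        lehmer_mesic_const)
  moreover have "int (num_updown_runs n \<sigma>) = ?g \<sigma>" if "\<sigma> \<in> Sym n" for \<sigma>
    unfolding num_updown_runs_def card_maximal_monotone_segments[OF that assms] by simp
  ultimately show ?thesis
    by (subst homomesic_cong)
qed

section \<open>Extremal entries\<close>

lemma lehmer_mesic_card_code_entries:
  "lehmer_mesic n (\<lambda>\<sigma>. int (card {i \<in> {1..n}. P i (lehmer_code n \<sigma> i)}))"
proof (rule lehmer_mesic_card_filter)
  fix i assume i: "i \<in> {1..n}"
  show "lehmer_mesic n (\<lambda>\<sigma>. of_bool (P i (lehmer_code n \<sigma> i)))"
    using depends_on_code_comp[OF depends_on_code_lehmer_code[OF singletonI]]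
    by (rule lehmer_mesic_if_code_entry[OF i])
qed simp

lemma lehmer_mesic_rl_maxima: "lehmer_mesic n (\<lambda>\<sigma>. int (card (rl_maxima n \<sigma>)))"
proof -
  have "rl_maxima n \<sigma> = {i \<in> {1..n}. n - i - lehmer_code n \<sigma> i = 0}" if \<sigma>: "\<sigma> \<in> Sym n" for \<sigma>
  proof -
    have "(\<forall>j\<in>{i<..n}. \<sigma> j < \<sigma> i) \<longleftrightarrow> card {j \<in> {i<..n}. \<sigma> i < \<sigma> j} = 0" for i
      using Sym_not_less_iff[OF \<sigma>, of i] by fastforce
    then show ?thesis
      unfolding rl_maxima_def card_later_greater[OF \<sigma>] by simp
  qed
  then show ?thesis
    using lehmer_mesic_card_code_entries[of n "\<lambda>i a. n - i - a = 0"]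
    by (subst homomesic_cong) simp_all
qed

lemma lehmer_mesic_rl_minima: "lehmer_mesic n (\<lambda>\<sigma>. int (card (rl_minima n \<sigma>)))"
proof -
  have "rl_minima n \<sigma> = {i \<in> {1..n}. lehmer_code n \<sigma> i = 0}" if \<sigma>: "\<sigma> \<in> Sym n" for \<sigma>
  proof -
    have "(\<forall>j\<in>{i<..n}. \<sigma> i < \<sigma> j) \<longleftrightarrow> lehmer_code n \<sigma> i = 0" for i
      unfolding lehmer_code_def using Sym_not_less_iff[OF \<sigma>, of _ i] by fastforce
    then show ?thesis
      unfolding rl_minima_def by simp
  qed
  then show ?thesis
    using lehmer_mesic_card_code_entries[of n "\<lambda>_ a. a = 0"] by (subst homomesic_cong) simp_all
qed

lemma first_entry_eq_lehmer_code:
  assumes \<sigma>: "\<sigma> \<in> Sym n" and "1 \<le> n"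
  shows "\<sigma> 1 = lehmer_code n \<sigma> 1 + 1"
proof -
  have "\<sigma> 1 \<in> {1..n}"
    using Sym_in_iff[OF \<sigma>, of 1] assms(2) by simp
  then have "{v \<in> {1..n} - \<sigma> ` {1..<1}. v < \<sigma> 1} = {1..<\<sigma> 1}"
    by auto
  then show ?thesis
    using lehmer_code_eq_card_values[OF \<sigma>, of 1] \<open>\<sigma> 1 \<in> {1..n}\<close> by simp
qed

lemma lehmer_mesic_first_entry:
  assumes "1 \<le> n"
  shows "lehmer_mesic n (\<lambda>\<sigma>. int (\<sigma> 1))"
proof -
  have "lehmer_mesic n (\<lambda>\<sigma>. int (lehmer_code n \<sigma> 1 + 1))"
    using assms depends_on_code_comp[OF depends_on_code_lehmer_code[OF singletonI]]
    by (intro lehmer_mesic_if_code_entry[of 1]) auto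
  moreover have "int (\<sigma> 1) = int (lehmer_code n \<sigma> 1 + 1)" if "\<sigma> \<in> Sym n" for \<sigma>
    using first_entry_eq_lehmer_code[OF that assms] by simp
  ultimately show ?thesis
    by (subst homomesic_cong)
qed

lemma all_smaller_before_iff:
  assumes \<sigma>: "\<sigma> \<in> Sym n" and i: "i \<in> {1..n}"
  shows "(\<forall>v\<in>{1..<\<sigma> i}. \<exists>j\<in>{1..<i}. \<sigma> j = v) \<longleftrightarrow> lehmer_code n \<sigma> i = 0"
proof -
  have "\<sigma> i \<le> n"
    using Sym_in_iff[OF \<sigma>, of i] i by simp
  then have "{v \<in> {1..n} - \<sigma> ` {1..<i}. v < \<sigma> i} = {1..<\<sigma> i} - \<sigma> ` {1..<i}"
    by auto
  then have "lehmer_code n \<sigma> i = card ({1..<\<sigma> i} - \<sigma> ` {1..<i})"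
    using lehmer_code_eq_card_values[OF \<sigma>, of i] i by simp
  then show ?thesis
    by auto
qed

lemma lehmer_mesic_complete_ascent_tops:
  "lehmer_mesic n
    (\<lambda>\<sigma>. int (card {i \<in> ascent_tops n \<sigma>. \<forall>v\<in>{1..<\<sigma> i}. \<exists>j\<in>{1..<i}. \<sigma> j = v}))"
proof -
  let ?P = "\<lambda>i \<sigma>. \<not> \<sigma> i < \<sigma> (i - 1) \<and> lehmer_code n \<sigma> i = 0"
  have "{i \<in> ascent_tops n \<sigma>. \<forall>v\<in>{1..<\<sigma> i}. \<exists>j\<in>{1..<i}. \<sigma> j = v} = {i \<in> {2..n}. ?P i \<sigma>}"
    if \<sigma>: "\<sigma> \<in> Sym n" for \<sigma>
  proof (rule Collect_cong)
    fix i
    have "\<sigma> (i - 1) < \<sigma> i \<longleftrightarrow> \<not> \<sigma> i < \<sigma> (i - 1)"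
      "(\<forall>v\<in>{1..<\<sigma> i}. \<exists>j\<in>{1..<i}. \<sigma> j = v) \<longleftrightarrow> lehmer_code n \<sigma> i = 0" if "i \<in> {2..n}"
      using that Sym_not_less_iff[OF \<sigma>, of i "i - 1"] all_smaller_before_iff[OF \<sigma>, of i] by auto
    then show "i \<in> ascent_tops n \<sigma> \<and> (\<forall>v\<in>{1..<\<sigma> i}. \<exists>j\<in>{1..<i}. \<sigma> j = v) \<longleftrightarrow>
        i \<in> {2..n} \<and> ?P i \<sigma>"
      unfolding ascent_tops_def by blast
  qed
  moreover have "lehmer_mesic n (\<lambda>\<sigma>. int (card {i \<in> {2..n}. ?P i \<sigma>}))"
  proof (rule lehmer_mesic_card_filter)
    fix i assume "i \<in> {2..n}"
    then obtain k where k: "i = k + 1" "1 \<le> k" "k < n"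
      by (auto intro: that[of "i - 1"])
    have "depends_on_code n {k, k + 1}
        (\<lambda>\<sigma>. of_bool (\<not> \<sigma> (k + 1) < \<sigma> k \<and> lehmer_code n \<sigma> (k + 1) = 0) :: int)"
      using depends_on_code_descent[OF k(3)]
      by (rule depends_on_code_comp2[OF _ depends_on_code_lehmer_code]) simp
    then show "lehmer_mesic n (\<lambda>\<sigma>. of_bool (?P i \<sigma>))"
      using lehmer_mesic_if_adjacent_code_entries[OF k(2,3)] k(1) by simp
  qed simp
  ultimately show ?thesis
    by (subst homomesic_cong) simp_all
qed

section \<open>The lexicographic rank\<close>

lemma one_line_lexord_iff:
  "(one_line n \<tau>, one_line n \<sigma>) \<in> lexord {(x, y). x < y} \<longleftrightarrow>
    (\<exists>i\<in>{1..n}. (\<forall>j\<in>{1..<i}. \<tau> j = \<sigma> j) \<and> \<tau> i < \<sigma> i)"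
proof -
  have length: "length (one_line n \<rho>) = n" for \<rho>
    by (simp add: one_line_def)
  have nth: "one_line n \<rho> ! k = \<rho> (Suc k)" if "k < n" for \<rho> k
    using that by (simp add: one_line_def del: upt_Suc)
  have take: "take k (one_line n \<rho>) = map \<rho> [1..<Suc k]" if "k < n" for \<rho> k
    using that by (simp add: one_line_def take_map del: upt_Suc)
  have "(one_line n \<tau>, one_line n \<sigma>) \<in> lexord {(x, y). x < y} \<longleftrightarrow>
      (\<exists>k<n. (\<forall>j\<in>{1..<Suc k}. \<tau> j = \<sigma> j) \<and> \<tau> (Suc k) < \<sigma> (Suc k))"
    unfolding lexord_take_index_conv by (auto simp: length nth take simp del: upt_Suc)
  also have "\<dots> \<longleftrightarrow> (\<exists>i\<in>Suc ` {..<n}. (\<forall>j\<in>{1..<i}. \<tau> j = \<sigma> j) \<and> \<tau> i < \<sigma> i)"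
    by blast
  also have "Suc ` {..<n} = {1..n}"
    by (simp add: image_Suc_lessThan)
  finally show ?thesis .
qed

text \<open>
  Up to the first position where two permutations differ, comparing them is the same as comparing
  their codes; the later code entries are unconstrained.
\<close>

lemma card_lex_smaller_at:
  assumes \<sigma>: "\<sigma> \<in> Sym n" and i: "i \<in> {1..n}"
  shows "card {\<tau> \<in> Sym n. (\<forall>j\<in>{1..<i}. \<tau> j = \<sigma> j) \<and> \<tau> i < \<sigma> i} =
    (\<Prod>j\<in>{1..n}. if j < i then 1 else if j = i then lehmer_code n \<sigma> i else n - j + 1)"
proof -
  define B where "B = (\<lambda>j. if j < i then {lehmer_code n \<sigma> j} else if j = i then {..<lehmer_code n \<sigma> i}
    else {..n - j})"
  have "(\<forall>j\<in>{1..n}. codeword n \<tau> j \<in> B j) \<longleftrightarrow> (\<forall>j\<in>{1..<i}. \<tau> j = \<sigma> j) \<and> \<tau> i < \<sigma> i"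
    if \<tau>: "\<tau> \<in> Sym n" for \<tau>
  proof -
    have "codeword n \<tau> j \<in> B j \<longleftrightarrow> (j < i \<longrightarrow> lehmer_code n \<tau> j = lehmer_code n \<sigma> j) \<and>
        (j = i \<longrightarrow> lehmer_code n \<tau> i < lehmer_code n \<sigma> i)" if "j \<in> {1..n}" for j
      using that by (auto simp: B_def lehmer_code_le)
    then have "(\<forall>j\<in>{1..n}. codeword n \<tau> j \<in> B j) \<longleftrightarrow>
        (\<forall>j\<in>{1..<i}. lehmer_code n \<tau> j = lehmer_code n \<sigma> j) \<and> lehmer_code n \<tau> i < lehmer_code n \<sigma> i"
      using i by auto
    also have "\<dots> \<longleftrightarrow> (\<forall>j\<in>{1..<i}. \<tau> j = \<sigma> j) \<and> \<tau> i < \<sigma> i"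
      using lehmer_code_prefix_eq_iff[OF \<tau> \<sigma>, of i] lehmer_code_less_iff[OF \<tau> \<sigma> i] i by auto
    finally show ?thesis .
  qed
  then have "bij_betw (codeword n) {\<tau> \<in> Sym n. (\<forall>j\<in>{1..<i}. \<tau> j = \<sigma> j) \<and> \<tau> i < \<sigma> i}
      {c \<in> codewords n. \<forall>j\<in>{1..n}. c j \<in> B j}"
    by (rule bij_betw_Collect[OF bij_betw_codeword])
  moreover have "B j \<subseteq> {..n - j}" for j
    using lehmer_code_le[of n \<sigma> j] by (auto simp: B_def)
  then have "{c \<in> codewords n. \<forall>j\<in>{1..n}. c j \<in> B j} = PiE {1..n} B"
    unfolding codewords_def by (intro set_eqI) (simp only: PiE_iff mem_Collect_eq, blast)
  ultimately have "card {\<tau> \<in> Sym n. (\<forall>j\<in>{1..<i}. \<tau> j = \<sigma> j) \<and> \<tau> i < \<sigma> i} = card (PiE {1..n} B)"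
    by (simp only: bij_betw_same_card)
  also have "\<dots> = (\<Prod>j\<in>{1..n}. if j < i then 1 else if j = i then lehmer_code n \<sigma> i else n - j + 1)"
    unfolding card_PiE[OF finite_atLeastAtMost] by (intro prod.cong) (auto simp: B_def)
  finally show ?thesis .
qed

lemma lehmer_mesic_lex_rank: "lehmer_mesic n (\<lambda>\<sigma>. int (lex_rank n \<sigma>))"
proof -
  let ?A = "\<lambda>\<sigma> i. {\<tau> \<in> Sym n. (\<forall>j\<in>{1..<i}. \<tau> j = \<sigma> j) \<and> \<tau> i < \<sigma> i}"
  have "int (lex_rank n \<sigma>) = 1 + (\<Sum>i\<in>{1..n}. int (card (?A \<sigma> i)))" for \<sigma>
  proof -
    have disjoint: "?A \<sigma> i \<inter> ?A \<sigma> j = {}" if "i \<in> {1..n}" "j \<in> {1..n}" "i \<noteq> j" for i j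
    proof -
      have "i \<in> {1..<j} \<or> j \<in> {1..<i}"
        using that by auto
      then show ?thesis
        by fastforce
    qed
    have "{\<tau> \<in> Sym n. (one_line n \<tau>, one_line n \<sigma>) \<in> lexord {(x, y). x < y}} = (\<Union>i\<in>{1..n}. ?A \<sigma> i)"
      unfolding one_line_lexord_iff by blast
    moreover have "card (\<Union>i\<in>{1..n}. ?A \<sigma> i) = (\<Sum>i\<in>{1..n}. card (?A \<sigma> i))"
      using disjoint by (intro card_UN_disjoint) (auto simp: finite_Sym)
    ultimately show ?thesis
      by (simp add: lex_rank_def)
  qed
  moreover have "lehmer_mesic n (\<lambda>\<sigma>. 1 + (\<Sum>i\<in>{1..n}. int (card (?A \<sigma> i))))"
  proof (intro homomesic_add lehmer_mesic_const lehmer_mesic_sum)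
    fix i assume i: "i \<in> {1..n}"
    have "depends_on_code n {i} (\<lambda>\<sigma>. card (?A \<sigma> i))"
      unfolding depends_on_code_def
      by (intro ballI impI) (simp only: card_lex_smaller_at[OF _ i], simp cong: if_cong)
    from depends_on_code_comp[OF this] show "lehmer_mesic n (\<lambda>\<sigma>. int (card (?A \<sigma> i)))"
      by (rule lehmer_mesic_if_code_entry[OF i])
  qed
  ultimately show ?thesis
    by simp
qed

section \<open>The permutation tree\<close>

lemma dropWhile_eq_filter_if_sorted:
  fixes x :: "'a::linorder"
  assumes "sorted_wrt (>) xs"
  shows "dropWhile (\<lambda>v. \<not> v < x) xs = filter (\<lambda>v. v < x) xs"
  using assms by (induction xs) (auto intro!: filter_True[symmetric])

lemma sorted_tree_path: "sorted_wrt (>) (tree_path \<sigma> i)"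
  by (induction i) (simp_all add: dropWhile_eq_filter_if_sorted sorted_wrt_filter)

lemma tree_path_Suc:
  "tree_path \<sigma> (Suc i) = \<sigma> (Suc i) # filter (\<lambda>v. v < \<sigma> (Suc i)) (tree_path \<sigma> i)"
  by (simp add: dropWhile_eq_filter_if_sorted[OF sorted_tree_path])

lemma in_tree_pathD:
  "v \<in> set (tree_path \<sigma> i) \<Longrightarrow> v = 0 \<or> (\<exists>k\<in>{1..i}. v = \<sigma> k \<and> (\<forall>j\<in>{k<..i}. \<sigma> k < \<sigma> j))"
proof (induction i)
  case (Suc i)
  show ?case
  proof (cases "v = \<sigma> (Suc i)")
    case False
    then have "v \<in> set (tree_path \<sigma> i)" "v < \<sigma> (Suc i)"
      using Suc.prems by (auto simp: tree_path_Suc simp del: tree_path.simps)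
    with Suc.IH show ?thesis
      by (fastforce simp: le_Suc_eq)
  qed auto
qed simp

lemma root_in_tree_path:
  assumes \<sigma>: "\<sigma> \<in> Sym n"
  shows "i \<le> n \<Longrightarrow> 0 \<in> set (tree_path \<sigma> i)"
proof (induction i)
  case (Suc i)
  then have "0 < \<sigma> (Suc i)"
    using Sym_in_iff[OF \<sigma>, of "Suc i"] by simp
  then show ?case
    using Suc by (simp add: tree_path_Suc del: tree_path.simps)
qed simp

lemma tree_parent_in_tree_path:
  assumes \<sigma>: "\<sigma> \<in> Sym n" and k: "k \<in> {1..n}"
  shows "tree_parent \<sigma> k \<in> set (tree_path \<sigma> (k - 1))" "tree_parent \<sigma> k < \<sigma> k"
proof -
  let ?smaller = "filter (\<lambda>v. v < \<sigma> k) (tree_path \<sigma> (k - 1))"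
  have "0 < \<sigma> k" "0 \<in> set (tree_path \<sigma> (k - 1))"
    using Sym_in_iff[OF \<sigma>, of k] root_in_tree_path[OF \<sigma>, of "k - 1"] k by auto
  then have "?smaller \<noteq> []"
    by (auto simp: filter_empty_conv)
  then have "tree_parent \<sigma> k \<in> set ?smaller"
    unfolding tree_parent_def dropWhile_eq_filter_if_sorted[OF sorted_tree_path] by (rule hd_in_set)
  then show "tree_parent \<sigma> k \<in> set (tree_path \<sigma> (k - 1))" "tree_parent \<sigma> k < \<sigma> k"
    by auto
qed

lemma tree_parent_ascent:
  assumes "1 \<le> i" "\<sigma> i < \<sigma> (i + 1)"
  shows "tree_parent \<sigma> (i + 1) = \<sigma> i"
  using assms by (cases i) (simp_all add: tree_parent_def)

lemma tree_parent_root_or_ascent: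
  assumes \<sigma>: "\<sigma> \<in> Sym n" and k: "k \<in> {1..n}"
  shows "tree_parent \<sigma> k \<in> insert 0 (\<sigma> ` ascents n \<sigma>)"
proof -
  have "tree_parent \<sigma> k = 0 \<or>
      (\<exists>i\<in>{1..k - 1}. tree_parent \<sigma> k = \<sigma> i \<and> (\<forall>j\<in>{i<..k - 1}. \<sigma> i < \<sigma> j))"
    by (rule in_tree_pathD[OF tree_parent_in_tree_path(1)[OF \<sigma> k]])
  then show ?thesis
  proof (elim disjE bexE conjE)
    fix i
    assume i: "i \<in> {1..k - 1}" "tree_parent \<sigma> k = \<sigma> i" "\<forall>j\<in>{i<..k - 1}. \<sigma> i < \<sigma> j"
    then have "\<sigma> i < \<sigma> (i + 1)"
      using tree_parent_in_tree_path(2)[OF \<sigma> k] by (cases "i + 1 = k") auto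
    then have "i \<in> ascents n \<sigma>"
      using i(1) k by (auto simp: in_ascents_iff)
    then show ?thesis
      using i(2) by blast
  qed simp
qed

lemma tree_parent_image:
  assumes \<sigma>: "\<sigma> \<in> Sym n" and n: "1 \<le> n"
  shows "tree_parent \<sigma> ` {1..n} = insert 0 (\<sigma> ` ascents n \<sigma>)"
proof
  show "tree_parent \<sigma> ` {1..n} \<subseteq> insert 0 (\<sigma> ` ascents n \<sigma>)"
    by (intro image_subsetI tree_parent_root_or_ascent[OF \<sigma>])
  have "tree_parent \<sigma> 1 = 0"
    using Sym_in_iff[OF \<sigma>, of 1] n by (simp add: tree_parent_def)
  moreover have "\<sigma> i = tree_parent \<sigma> (i + 1)" "i + 1 \<in> {1..n}" if "i \<in> ascents n \<sigma>" for i
    using that tree_parent_ascent[of i \<sigma>] Sym_not_less_iff[OF \<sigma>, of "i + 1" i]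
    by (auto simp: in_ascents_iff)
  ultimately show "insert 0 (\<sigma> ` ascents n \<sigma>) \<subseteq> tree_parent \<sigma> ` {1..n}"
    using n by force
qed

lemma card_tree_leaves:
  assumes \<sigma>: "\<sigma> \<in> Sym n" and n: "1 \<le> n"
  shows "int (card (tree_leaves n \<sigma>)) = int n - int (card (ascents n \<sigma>))"
proof -
  have ascents: "ascents n \<sigma> \<subseteq> {1..<n}"
    by (auto simp: in_ascents_iff)
  then have image: "\<sigma> ` ascents n \<sigma> \<subseteq> {1..n}"
    using Sym_in_iff[OF \<sigma>] by fastforce
  have "finite (ascents n \<sigma>)" "0 \<notin> \<sigma> ` ascents n \<sigma>"
    using finite_subset[OF ascents] image by auto
  then have "card (insert 0 (\<sigma> ` ascents n \<sigma>)) = card (ascents n \<sigma>) + 1"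
    by (simp add: card_image[OF Sym_inj_on[OF \<sigma>]])
  moreover have "tree_leaves n \<sigma> = {0..n} - insert 0 (\<sigma> ` ascents n \<sigma>)"
    unfolding tree_parent_image[OF assms, symmetric] by (auto simp: tree_leaves_def)
  moreover have "insert 0 (\<sigma> ` ascents n \<sigma>) \<subseteq> {0..n}"
    using image by auto
  ultimately show ?thesis
    using card_mono[of "{0..n}" "insert 0 (\<sigma> ` ascents n \<sigma>)"]
    by (simp add: card_Diff_subset finite_subset)
qed

lemma lehmer_mesic_tree_leaves:
  assumes "1 \<le> n"
  shows "lehmer_mesic n (\<lambda>\<sigma>. int (card (tree_leaves n \<sigma>)))"
proof -
  have "lehmer_mesic n (\<lambda>\<sigma>. int n - int (card (ascents n \<sigma>)))"
    by (intro homomesic_diff lehmer_mesic_const lehmer_mesic_ascents)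
  then show ?thesis
    using card_tree_leaves[OF _ assms] by (subst homomesic_cong) simp_all
qed

theorem theorem4p6:
  fixes n :: nat
  assumes "n \<ge> 1"
  shows "\<forall>f \<in> set [
    \<lambda>\<sigma>. int (card (inversions n \<sigma>)),
    \<lambda>\<sigma>. int (card (noninversions n \<sigma>)),
    \<lambda>\<sigma>. int (card {(i, j) \<in> inversions n \<sigma>. j - i \<le> 2}),
    \<lambda>\<sigma>. int (card {j \<in> {3<..n}. \<sigma> j < \<sigma> 3}),
    \<lambda>\<sigma>. int (card {j \<in> {2<..n}. \<sigma> j < \<sigma> 2}),
    \<lambda>\<sigma>. int (major_index n \<sigma>),
    \<lambda>\<sigma>. int (card (descents n \<sigma>)),
    \<lambda>\<sigma>. int (card (peaks n \<sigma>)),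
    \<lambda>\<sigma>. int (card (left_outer_peaks n \<sigma>)),
    \<lambda>\<sigma>. int (num_outer_peaks n \<sigma>),
    \<lambda>\<sigma>. int (num_valleys_with_boundary n \<sigma>),
    \<lambda>\<sigma>. int (card (ascents n \<sigma>)),
    \<lambda>\<sigma>. int (card (valleys n \<sigma>)),
    \<lambda>\<sigma>. int (card (double_ascents n \<sigma>)),
    \<lambda>\<sigma>. int (card (double_descents n \<sigma>)),
    \<lambda>\<sigma>. int (card (runs n \<sigma>)),
    \<lambda>\<sigma>. int (card (peaks n \<sigma>) + card (valleys n \<sigma>)),
    \<lambda>\<sigma>. int (num_updown_runs n \<sigma>),
    \<lambda>\<sigma>. int (comajor_index n \<sigma>),
    \<lambda>\<sigma>. int (card (right_outer_peaks n \<sigma>)),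
    \<lambda>\<sigma>. int (card (descents_dist2 n \<sigma>)),
    \<lambda>\<sigma>. int (card (ascents_dist2 n \<sigma>)),
    \<lambda>\<sigma>. int (card {i \<in> descents n \<sigma>. odd i}),
    \<lambda>\<sigma>. int (card {i \<in> descents n \<sigma>. even i}),
    \<lambda>\<sigma>. int (card (vinc_occurrences [2, 1, 3] n \<sigma>)),
    \<lambda>\<sigma>. int (card (vinc_occurrences [1, 3, 2] n \<sigma>)),
    \<lambda>\<sigma>. int (card (vinc_occurrences [1, 2, 3] n \<sigma>)),
    \<lambda>\<sigma>. int (card (vinc_occurrences [3, 1, 2] n \<sigma>)),
    \<lambda>\<sigma>. int (card (vinc_occurrences [2, 3, 1] n \<sigma>)),
    \<lambda>\<sigma>. int (card (vinc_occurrences [3, 2, 1] n \<sigma>)),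
    \<lambda>\<sigma>. int (card (occurrences [1, 2, 3] n \<sigma>) + card (occurrences [1, 3, 2] n \<sigma>)),
    \<lambda>\<sigma>. int (card (occurrences [2, 1, 3] n \<sigma>) + card (occurrences [2, 3, 1] n \<sigma>)),
    \<lambda>\<sigma>. int (card (occurrences [3, 1, 2] n \<sigma>) + card (occurrences [3, 2, 1] n \<sigma>)),
    \<lambda>\<sigma>. int (card (occurrences_14_23 n \<sigma>)),
    \<lambda>\<sigma>. int (card (occurrences_initial_123 n \<sigma>)),
    \<lambda>\<sigma>. int (card (rl_maxima n \<sigma>)),
    \<lambda>\<sigma>. int (lex_rank n \<sigma>),
    \<lambda>\<sigma>. int (\<sigma> 1),
    \<lambda>\<sigma>. int (card (tree_leaves n \<sigma>)),
    \<lambda>\<sigma>. int (bs_stat n \<sigma>),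
    \<lambda>\<sigma>. int (bs_stat' n \<sigma>),
    \<lambda>\<sigma>. int (card (rl_minima n \<sigma>)),
    \<lambda>\<sigma>. int (major_index n \<sigma>) - int (card (inversions n \<sigma>)),
    \<lambda>\<sigma>. int (card (inversions n \<sigma>)) + int (major_index n \<sigma>),
    \<lambda>\<sigma>. int (card {i \<in> ascent_tops n \<sigma>. \<forall>v\<in>{1..<\<sigma> i}. \<exists>j\<in>{1..<i}. \<sigma> j = v})
  ]. homomesic (Sym n) (lehmer_rotation n) f"
  unfolding list.set ball_simps
  by (intro conjI TrueI lehmer_mesic_inversions lehmer_mesic_noninversions
      lehmer_mesic_short_inversions lehmer_mesic_inversions_at
      lehmer_mesic_major_index lehmer_mesic_comajor_index lehmer_mesic_descents
      lehmer_mesic_descents_filter lehmer_mesic_ascents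
      lehmer_mesic_peaks lehmer_mesic_left_outer_peaks lehmer_mesic_right_outer_peaks
      lehmer_mesic_num_outer_peaks lehmer_mesic_valleys lehmer_mesic_num_valleys_with_boundary
      lehmer_mesic_double_ascents lehmer_mesic_double_descents lehmer_mesic_switches
      lehmer_mesic_runs lehmer_mesic_num_updown_runs
      lehmer_mesic_descents_dist2 lehmer_mesic_ascents_dist2
      lehmer_mesic_vinc_occurrences lehmer_mesic_123_132 lehmer_mesic_213_231 lehmer_mesic_312_321
      lehmer_mesic_occurrences_14_23 lehmer_mesic_initial_123 lehmer_mesic_bs_stat
      lehmer_mesic_bs_stat' lehmer_mesic_rl_maxima lehmer_mesic_rl_minima lehmer_mesic_first_entry
      lehmer_mesic_complete_ascent_tops lehmer_mesic_lex_rank lehmer_mesic_tree_leaves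
      homomesic_diff homomesic_add assms) simp_all

end
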